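(* Let $\mathcal{C}$ be a strict monoidal category (with product $\oplus$) whose unit object is null (both initial and terminal), and suppose that $\mathcal{C}$ is generated by an object $x$ in the sense that every object of $\mathcal{C}$ is isomorphic to $x^{\oplus n}$ for some non-negative integer $n$. Let $\mathcal{A}$ be an abelian category. Then for any functor $T\colon\mathcal{C}\to\mathcal{A}$ we have $\mathrm{ht}_{\mathcal{I}}(T)\leq\mathrm{ht}_{\oplus}(T)$. If moreover $\mathcal{C}$ is braided, then $\mathrm{ht}_{\mathcal{I}}(T)=\mathrm{ht}_{\oplus}(T)$.
   Context: Write $\underline{n}=\{1,\ldots,n\}$. In $\mathcal{C}$, a zero morphism ($0$) is one that factors through the (null) unit object. **$\mathrm{ht}_{\oplus}$.** For $n\geq0$ and an $n$-tuple $(x_1,\ldots,x_n)$ of objects of $\mathcal{C}$, and $S\subseteq\underline{n}$, let $\phi_S$ be the endomorphism $\bigoplus_{i=1}^n\phi_i$ of $\bigoplus_{i=1}^n x_i$ with $\phi_i=\mathrm{id}_{x_i}$ if $i\in S$ and $\phi_i=0$ otherwise. Then $\mathrm{ht}_{\oplus}(T)\in\{-1,0,1,\ldots,\infty\}$ is defined by: $\mathrm{ht}_{\oplus}(T)\leq h$ iff for all $n>h$ and all $n$-tuples $(x_1,\ldots,x_n)$ of objects of $\mathcal{C}$ the endomorphism $\sum_{S\subseteq\underline{n}}(-1)^{|S|}T(\phi_{\underline{n}\smallsetminus S})$ of $T(\bigoplus_i x_i)$ has zero image. **$\mathrm{ht}_{\mathcal{I}}$.** $\mathcal{I}$ is the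 category with objects the non-negative integers and morphisms $m\to n$ the subsets of $\{1,\ldots,\min(m,n)\}$, composed by intersection. There is a natural functor $s\colon\mathcal{I}\to\mathcal{C}$ with $s(n)=x^{\oplus n}$, sending $R\subseteq\{1,\ldots,\mu\}$, $\mu=\min(m,n)$, viewed as a morphism $m\to n$, to $\bigl(\bigoplus_{i=1}^{\mu}\phi_i\bigr)\oplus 0\colon x^{\oplus\mu}\oplus x^{\oplus(m-\mu)}\to x^{\oplus\mu}\oplus x^{\oplus(n-\mu)}$, where $\phi_i=\mathrm{id}_x$ if $i\in R$ and $\phi_i=0$ otherwise. For $Q\subseteq\underline{m}$ let $f_Q\colon m\to m$ be the morphism of $\mathcal{I}$ given by the subset $\underline{m}\smallsetminus Q$. Then $\mathrm{ht}_{\mathcal{I}}(T)\in\{-1,0,1,\ldots,\infty\}$ is defined by: $\mathrm{ht}_{\mathcal{I}}(T)\leq h$ iff for all $m\geq n>h$ (with $n\geq 0$) the endomorphism $\sum_{S\subseteq\{m-n+1,\ldots,m\}}(-1)^{|S|}\,Ts(f_{S\cup\{1,\ldots,m-n\}})$ of $Ts(m)$ has zero image. *)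

theory Defs
  imports "HOL-Algebra.FiniteProduct" "HOL-Library.Extended_Real"
begin

section \<open>Categories and functors\<close>

record ('o, 'm) cat =
  Ob :: "'o set"
  Ar :: "'m set"
  Dom :: "'m \<Rightarrow> 'o"
  Cod :: "'m \<Rightarrow> 'o"
  Ident :: "'o \<Rightarrow> 'm"
  Comp :: "'m \<Rightarrow> 'm \<Rightarrow> 'm"  (infixr "\<cdot>\<index>" 70)

definition homset :: "('o, 'm, 'z) cat_scheme \<Rightarrow> 'o \<Rightarrow> 'o \<Rightarrow> 'm set" where
  "homset C a b = {f \<in> Ar C. Dom C f = a \<and> Cod C f = b}"

locale category =
  fixes C :: "('o, 'm, 'z) cat_scheme" (structure)
  assumes dom_closed: "f \<in> Ar C \<Longrightarrow> Dom C f \<in> Ob C"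
    and cod_closed: "f \<in> Ar C \<Longrightarrow> Cod C f \<in> Ob C"
    and id_closed: "a \<in> Ob C \<Longrightarrow> Ident C a \<in> homset C a a"
    and comp_closed: "f \<in> homset C a b \<Longrightarrow> g \<in> homset C b c \<Longrightarrow> g \<cdot> f \<in> homset C a c"
    and comp_id_right: "f \<in> homset C a b \<Longrightarrow> f \<cdot> Ident C a = f"
    and comp_id_left: "f \<in> homset C a b \<Longrightarrow> Ident C b \<cdot> f = f"
    and comp_assoc: "f \<in> homset C a b \<Longrightarrow> g \<in> homset C b c \<Longrightarrow> h \<in> homset C c d \<Longrightarrow>
      (h \<cdot> g) \<cdot> f = h \<cdot> (g \<cdot> f)"

definition is_iso :: "('o, 'm, 'z) cat_scheme \<Rightarrow> 'm \<Rightarrow> bool" where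
  "is_iso C f \<longleftrightarrow> f \<in> Ar C \<and> (\<exists>g \<in> homset C (Cod C f) (Dom C f).
     g \<cdot>\<^bsub>C\<^esub> f = Ident C (Dom C f) \<and> f \<cdot>\<^bsub>C\<^esub> g = Ident C (Cod C f))"

definition isomorphic :: "('o, 'm, 'z) cat_scheme \<Rightarrow> 'o \<Rightarrow> 'o \<Rightarrow> bool" where
  "isomorphic C a b \<longleftrightarrow> (\<exists>f \<in> homset C a b. is_iso C f)"

definition is_mono :: "('o, 'm, 'z) cat_scheme \<Rightarrow> 'm \<Rightarrow> bool" where
  "is_mono C f \<longleftrightarrow> f \<in> Ar C \<and> (\<forall>a. \<forall>g \<in> homset C a (Dom C f). \<forall>h \<in> homset C a (Dom C f).
     f \<cdot>\<^bsub>C\<^esub> g = f \<cdot>\<^bsub>C\<^esub> h \<longrightarrow> g = h)"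

definition is_epi :: "('o, 'm, 'z) cat_scheme \<Rightarrow> 'm \<Rightarrow> bool" where
  "is_epi C f \<longleftrightarrow> f \<in> Ar C \<and> (\<forall>b. \<forall>g \<in> homset C (Cod C f) b. \<forall>h \<in> homset C (Cod C f) b.
     g \<cdot>\<^bsub>C\<^esub> f = h \<cdot>\<^bsub>C\<^esub> f \<longrightarrow> g = h)"

definition is_initial :: "('o, 'm, 'z) cat_scheme \<Rightarrow> 'o \<Rightarrow> bool" where
  "is_initial C z \<longleftrightarrow> z \<in> Ob C \<and> (\<forall>a \<in> Ob C. \<exists>!f. f \<in> homset C z a)"

definition is_terminal :: "('o, 'm, 'z) cat_scheme \<Rightarrow> 'o \<Rightarrow> bool" where
  "is_terminal C z \<longleftrightarrow> z \<in> Ob C \<and> (\<forall>a \<in> Ob C. \<exists>!f. f \<in> homset C a z)"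

definition is_null :: "('o, 'm, 'z) cat_scheme \<Rightarrow> 'o \<Rightarrow> bool" where
  "is_null C z \<longleftrightarrow> is_initial C z \<and> is_terminal C z"

record ('o, 'm, 'p, 'n) fctr =
  OMap :: "'o \<Rightarrow> 'p"
  AMap :: "'m \<Rightarrow> 'n"

locale cat_functor = C: category C + D: category D
  for C :: "('o, 'm, 'y) cat_scheme" and D :: "('p, 'n, 'z) cat_scheme" +
  fixes T :: "('o, 'm, 'p, 'n) fctr"
  assumes omap_closed: "a \<in> Ob C \<Longrightarrow> OMap T a \<in> Ob D"
    and amap_closed: "f \<in> homset C a b \<Longrightarrow> AMap T f \<in> homset D (OMap T a) (OMap T b)"
    and amap_id: "a \<in> Ob C \<Longrightarrow> AMap T (Ident C a) = Ident D (OMap T a)"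
    and amap_comp: "f \<in> homset C a b \<Longrightarrow> g \<in> homset C b c \<Longrightarrow>
      AMap T (g \<cdot>\<^bsub>C\<^esub> f) = AMap T g \<cdot>\<^bsub>D\<^esub> AMap T f"

definition fcomp :: "('p, 'n, 'q, 'k) fctr \<Rightarrow> ('o, 'm, 'p, 'n) fctr \<Rightarrow> ('o, 'm, 'q, 'k) fctr" where
  "fcomp T S = \<lparr>OMap = OMap T \<circ> OMap S, AMap = AMap T \<circ> AMap S\<rparr>"


section \<open>Strict monoidal categories\<close>

record ('o, 'm) mcat = "('o, 'm) cat" +
  Unit :: "'o"
  TensO :: "'o \<Rightarrow> 'o \<Rightarrow> 'o"  (infixl "\<oplus>\<^sub>o\<index>" 65)
  TensM :: "'m \<Rightarrow> 'm \<Rightarrow> 'm"  (infixl "\<oplus>\<^sub>m\<index>" 65)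

locale strict_monoidal_category = category C
  for C :: "('o, 'm, 'z) mcat_scheme" (structure) +
  assumes unit_closed: "Unit C \<in> Ob C"
    and tenso_closed: "a \<in> Ob C \<Longrightarrow> b \<in> Ob C \<Longrightarrow> a \<oplus>\<^sub>o b \<in> Ob C"
    and tensm_closed: "f \<in> homset C a b \<Longrightarrow> g \<in> homset C c d \<Longrightarrow>
      f \<oplus>\<^sub>m g \<in> homset C (a \<oplus>\<^sub>o c) (b \<oplus>\<^sub>o d)"
    and tensm_id: "a \<in> Ob C \<Longrightarrow> b \<in> Ob C \<Longrightarrow>
      Ident C a \<oplus>\<^sub>m Ident C b = Ident C (a \<oplus>\<^sub>o b)"
    and tensm_comp: "f \<in> homset C a b \<Longrightarrow> g \<in> homset C b c \<Longrightarrow>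
      f' \<in> homset C a' b' \<Longrightarrow> g' \<in> homset C b' c' \<Longrightarrow>
      (g \<cdot> f) \<oplus>\<^sub>m (g' \<cdot> f') = (g \<oplus>\<^sub>m g') \<cdot> (f \<oplus>\<^sub>m f')"
    and tenso_assoc: "a \<in> Ob C \<Longrightarrow> b \<in> Ob C \<Longrightarrow> c \<in> Ob C \<Longrightarrow>
      (a \<oplus>\<^sub>o b) \<oplus>\<^sub>o c = a \<oplus>\<^sub>o (b \<oplus>\<^sub>o c)"
    and tenso_unit_left: "a \<in> Ob C \<Longrightarrow> Unit C \<oplus>\<^sub>o a = a"
    and tenso_unit_right: "a \<in> Ob C \<Longrightarrow> a \<oplus>\<^sub>o Unit C = a"
    and tensm_assoc: "f \<in> Ar C \<Longrightarrow> g \<in> Ar C \<Longrightarrow> h \<in> Ar C \<Longrightarrow>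
      (f \<oplus>\<^sub>m g) \<oplus>\<^sub>m h = f \<oplus>\<^sub>m (g \<oplus>\<^sub>m h)"
    and tensm_unit_left: "f \<in> Ar C \<Longrightarrow> Ident C (Unit C) \<oplus>\<^sub>m f = f"
    and tensm_unit_right: "f \<in> Ar C \<Longrightarrow> f \<oplus>\<^sub>m Ident C (Unit C) = f"

text \<open>In the strict case the associators in the two hexagon axioms are identities.\<close>

locale braiding = strict_monoidal_category C
  for C :: "('o, 'm, 'z) mcat_scheme" (structure) +
  fixes \<beta> :: "'o \<Rightarrow> 'o \<Rightarrow> 'm"
  assumes braid_closed: "a \<in> Ob C \<Longrightarrow> b \<in> Ob C \<Longrightarrow> \<beta> a b \<in> homset C (a \<oplus>\<^sub>o b) (b \<oplus>\<^sub>o a)"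
    and braid_iso: "a \<in> Ob C \<Longrightarrow> b \<in> Ob C \<Longrightarrow> is_iso C (\<beta> a b)"
    and braid_natural: "f \<in> homset C a a' \<Longrightarrow> g \<in> homset C b b' \<Longrightarrow>
      \<beta> a' b' \<cdot> (f \<oplus>\<^sub>m g) = (g \<oplus>\<^sub>m f) \<cdot> \<beta> a b"
    and braid_hexagon_left: "a \<in> Ob C \<Longrightarrow> b \<in> Ob C \<Longrightarrow> c \<in> Ob C \<Longrightarrow>
      \<beta> (a \<oplus>\<^sub>o b) c = (\<beta> a c \<oplus>\<^sub>m Ident C b) \<cdot> (Ident C a \<oplus>\<^sub>m \<beta> b c)"
    and braid_hexagon_right: "a \<in> Ob C \<Longrightarrow> b \<in> Ob C \<Longrightarrow> c \<in> Ob C \<Longrightarrow>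
      \<beta> a (b \<oplus>\<^sub>o c) = (Ident C b \<oplus>\<^sub>m \<beta> a c) \<cdot> (\<beta> a b \<oplus>\<^sub>m Ident C c)"

definition braided :: "('o, 'm, 'z) mcat_scheme \<Rightarrow> bool" where
  "braided C \<longleftrightarrow> (\<exists>\<beta>. braiding C \<beta>)"

primrec osum :: "('o, 'm, 'z) mcat_scheme \<Rightarrow> (nat \<Rightarrow> 'o) \<Rightarrow> nat \<Rightarrow> 'o" where
  "osum C x 0 = Unit C"
| "osum C x (Suc n) = osum C x n \<oplus>\<^sub>o\<^bsub>C\<^esub> x (Suc n)"

primrec msum :: "('o, 'm, 'z) mcat_scheme \<Rightarrow> (nat \<Rightarrow> 'm) \<Rightarrow> nat \<Rightarrow> 'm" where
  "msum C f 0 = Ident C (Unit C)"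
| "msum C f (Suc n) = msum C f n \<oplus>\<^sub>m\<^bsub>C\<^esub> f (Suc n)"

abbreviation opow :: "('o, 'm, 'z) mcat_scheme \<Rightarrow> 'o \<Rightarrow> nat \<Rightarrow> 'o" where
  "opow C x n \<equiv> osum C (\<lambda>_. x) n"

definition generated_by :: "('o, 'm, 'z) mcat_scheme \<Rightarrow> 'o \<Rightarrow> bool" where
  "generated_by C x \<longleftrightarrow> x \<in> Ob C \<and> (\<forall>a \<in> Ob C. \<exists>n. isomorphic C a (opow C x n))"

text \<open>Meaningful when the unit is null; then exactly one morphism from \<open>a\<close> to \<open>b\<close> factors
  through the unit.\<close>

definition zero_mor :: "('o, 'm, 'z) mcat_scheme \<Rightarrow> 'o \<Rightarrow> 'o \<Rightarrow> 'm" where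
  "zero_mor C a b =
     (THE f. \<exists>g \<in> homset C a (Unit C). \<exists>h \<in> homset C (Unit C) b. f = h \<cdot>\<^bsub>C\<^esub> g)"

definition phi :: "('o, 'm, 'z) mcat_scheme \<Rightarrow> (nat \<Rightarrow> 'o) \<Rightarrow> nat set \<Rightarrow> nat \<Rightarrow> 'm" where
  "phi C x S i = (if i \<in> S then Ident C (x i) else zero_mor C (x i) (x i))"


section \<open>Abelian categories\<close>

record ('o, 'm) acat = "('o, 'm) cat" +
  AddM :: "'m \<Rightarrow> 'm \<Rightarrow> 'm"
  ZeroM :: "'o \<Rightarrow> 'o \<Rightarrow> 'm"

text \<open>The additive group of morphisms from \<open>a\<close> to \<open>b\<close>; HOL-Algebra's group operations are
  written multiplicatively, so \<open>\<otimes>\<close>, \<open>\<one>\<close>, \<open>[^]\<close> and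
  \<^const>\<open>finprod\<close> are addition, zero, integer multiples and finite sums of morphisms.\<close>

definition hom_group :: "('o, 'm, 'z) acat_scheme \<Rightarrow> 'o \<Rightarrow> 'o \<Rightarrow> 'm monoid" where
  "hom_group A a b = \<lparr>carrier = homset A a b, mult = AddM A, one = ZeroM A a b\<rparr>"

definition is_kernel :: "('o, 'm, 'z) acat_scheme \<Rightarrow> 'm \<Rightarrow> 'm \<Rightarrow> bool" where
  "is_kernel A k f \<longleftrightarrow> f \<in> Ar A \<and> k \<in> Ar A \<and> Cod A k = Dom A f \<and>
     f \<cdot>\<^bsub>A\<^esub> k = ZeroM A (Dom A k) (Cod A f) \<and>
     (\<forall>g \<in> Ar A. Cod A g = Dom A f \<and> f \<cdot>\<^bsub>A\<^esub> g = ZeroM A (Dom A g) (Cod A f) \<longrightarrow>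
        (\<exists>!h. h \<in> homset A (Dom A g) (Dom A k) \<and> k \<cdot>\<^bsub>A\<^esub> h = g))"

definition is_cokernel :: "('o, 'm, 'z) acat_scheme \<Rightarrow> 'm \<Rightarrow> 'm \<Rightarrow> bool" where
  "is_cokernel A q f \<longleftrightarrow> f \<in> Ar A \<and> q \<in> Ar A \<and> Dom A q = Cod A f \<and>
     q \<cdot>\<^bsub>A\<^esub> f = ZeroM A (Dom A f) (Cod A q) \<and>
     (\<forall>g \<in> Ar A. Dom A g = Cod A f \<and> g \<cdot>\<^bsub>A\<^esub> f = ZeroM A (Dom A f) (Cod A g) \<longrightarrow>
        (\<exists>!h. h \<in> homset A (Cod A q) (Cod A g) \<and> h \<cdot>\<^bsub>A\<^esub> q = g))"

definition is_biproduct ::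
    "('o, 'm, 'z) acat_scheme \<Rightarrow> 'o \<Rightarrow> 'o \<Rightarrow> 'o \<Rightarrow> 'm \<Rightarrow> 'm \<Rightarrow> 'm \<Rightarrow> 'm \<Rightarrow> bool" where
  "is_biproduct A a b c i j p q \<longleftrightarrow> c \<in> Ob A \<and>
     i \<in> homset A a c \<and> j \<in> homset A b c \<and> p \<in> homset A c a \<and> q \<in> homset A c b \<and>
     p \<cdot>\<^bsub>A\<^esub> i = Ident A a \<and> q \<cdot>\<^bsub>A\<^esub> j = Ident A b \<and>
     AddM A (i \<cdot>\<^bsub>A\<^esub> p) (j \<cdot>\<^bsub>A\<^esub> q) = Ident A c"

locale abelian_category = category A
  for A :: "('o, 'm, 'z) acat_scheme" (structure) +
  assumes hom_comm_group: "a \<in> Ob A \<Longrightarrow> b \<in> Ob A \<Longrightarrow> comm_group (hom_group A a b)"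
    and comp_add_right: "f \<in> homset A a b \<Longrightarrow> f' \<in> homset A a b \<Longrightarrow> g \<in> homset A b c \<Longrightarrow>
      g \<cdot> AddM A f f' = AddM A (g \<cdot> f) (g \<cdot> f')"
    and comp_add_left: "f \<in> homset A a b \<Longrightarrow> g \<in> homset A b c \<Longrightarrow> g' \<in> homset A b c \<Longrightarrow>
      AddM A g g' \<cdot> f = AddM A (g \<cdot> f) (g' \<cdot> f)"
    and ex_null: "\<exists>z. is_null A z"
    and ex_biproduct: "a \<in> Ob A \<Longrightarrow> b \<in> Ob A \<Longrightarrow> \<exists>c i j p q. is_biproduct A a b c i j p q"
    and ex_kernel: "f \<in> Ar A \<Longrightarrow> \<exists>k. is_kernel A k f"
    and ex_cokernel: "f \<in> Ar A \<Longrightarrow> \<exists>q. is_cokernel A q f"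
    and mono_is_kernel: "is_mono A k \<Longrightarrow> \<exists>f. is_kernel A k f"
    and epi_is_cokernel: "is_epi A q \<Longrightarrow> \<exists>f. is_cokernel A q f"

text \<open>The image of a morphism is the kernel of its cokernel.\<close>

definition is_image :: "('o, 'm, 'z) acat_scheme \<Rightarrow> 'm \<Rightarrow> 'm \<Rightarrow> bool" where
  "is_image A i f \<longleftrightarrow> (\<exists>q. is_cokernel A q f \<and> is_kernel A i q)"

definition has_zero_image :: "('o, 'm, 'z) acat_scheme \<Rightarrow> 'm \<Rightarrow> bool" where
  "has_zero_image A f \<longleftrightarrow> (\<exists>i. is_image A i f \<and> is_null A (Dom A i))"

text \<open>The alternating sum of \<open>(-1)\<^bsup>card S\<^esup> F S\<close> over all subsets \<open>S\<close> of \<open>U\<close>,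
  in the endomorphism group of \<open>a\<close>.\<close>

definition alt_sum :: "('o, 'm, 'z) acat_scheme \<Rightarrow> 'o \<Rightarrow> nat set \<Rightarrow> (nat set \<Rightarrow> 'm) \<Rightarrow> 'm" where
  "alt_sum A a U F = finprod (hom_group A a a)
     (\<lambda>S. F S [^]\<^bsub>hom_group A a a\<^esub> ((-1) ^ card S :: int)) (Pow U)"


section \<open>Heights\<close>

text \<open>The least \<open>h\<close> in \<open>{-1, 0, 1, \<dots>, \<infinity>}\<close> such that \<open>P n\<close> holds for all natural \<open>n > h\<close>.\<close>

definition height :: "(nat \<Rightarrow> bool) \<Rightarrow> ereal" where
  "height P = Inf {ereal (of_int h) |h. h \<ge> -1 \<and> (\<forall>n. int n > h \<longrightarrow> P n)}"

lemma height_le_iff: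
  assumes "h \<ge> -1"
  shows "height P \<le> ereal (of_int h) \<longleftrightarrow> (\<forall>n. int n > h \<longrightarrow> P n)"
proof
  assume "\<forall>n. int n > h \<longrightarrow> P n"
  then show "height P \<le> ereal (of_int h)"
    unfolding height_def using assms by (intro Inf_lower) auto
next
  assume le: "height P \<le> ereal (of_int h)"
  have "height P < ereal (of_int (h + 1))"
    using le by (rule order.strict_trans1) simp
  then obtain k where "ereal (of_int k) < ereal (of_int (h + 1))"
      and k: "\<forall>n. int n > k \<longrightarrow> P n"
    unfolding height_def Inf_less_iff by blast
  then have "k \<le> h" by simp
  with k show "\<forall>n. int n > h \<longrightarrow> P n" by auto
qed

lemma height_range: "height P = \<infinity> \<or> (\<exists>h \<ge> -1. height P = ereal (of_int h))"
proof (cases "\<exists>h \<ge> -1. \<forall>n. int n > h \<longrightarrow> P n")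
  case False
  then have "{ereal (of_int h) |h. h \<ge> -1 \<and> (\<forall>n. int n > h \<longrightarrow> P n)} = {}" by blast
  then have "height P = \<infinity>" unfolding height_def by (simp only: Inf_empty top_ereal_def)
  then show ?thesis ..
next
  case True
  define Q where "Q k \<longleftrightarrow> (\<forall>n. int n > int k - 1 \<longrightarrow> P n)" for k :: nat
  from True obtain h where "h \<ge> -1" "\<forall>n. int n > h \<longrightarrow> P n" by blast
  then have ex: "Q (nat (h + 1))" unfolding Q_def by simp
  define L where "L = (LEAST k. Q k)"
  have "Q L" unfolding L_def using ex by (rule LeastI)
  have L_le: "L \<le> k" if "Q k" for k unfolding L_def using that by (rule Least_le)
  have lower: "ereal (of_int (int L - 1)) \<le> height P"
    unfolding height_def
  proof (rule Inf_greatest)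
    fix e assume "e \<in> {ereal (of_int h) |h. h \<ge> -1 \<and> (\<forall>n. int n > h \<longrightarrow> P n)}"
    then obtain k where k: "e = ereal (of_int k)" "k \<ge> -1" "\<forall>n. int n > k \<longrightarrow> P n" by blast
    then have "Q (nat (k + 1))" unfolding Q_def by simp
    then have "int L - 1 \<le> k" using L_le[of "nat (k + 1)"] k(2) by linarith
    then show "ereal (of_int (int L - 1)) \<le> e"
      unfolding k(1) ereal_less_eq of_int_le_iff .
  qed
  have ge: "int L - 1 \<ge> -1" by simp
  have "\<forall>n. int n > int L - 1 \<longrightarrow> P n" using \<open>Q L\<close> unfolding Q_def .
  then have upper: "height P \<le> ereal (of_int (int L - 1))"
    by (rule iffD2[OF height_le_iff[OF ge]])
  have "height P = ereal (of_int (int L - 1))"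
    by (rule order_antisym[OF upper lower])
  then show ?thesis using ge by blast
qed

definition ht_oplus ::
    "('o, 'm, 'y) mcat_scheme \<Rightarrow> ('p, 'n, 'z) acat_scheme \<Rightarrow> ('o, 'm, 'p, 'n) fctr \<Rightarrow> ereal" where
  "ht_oplus C A T = height (\<lambda>n. \<forall>x. (\<forall>i \<in> {1..n}. x i \<in> Ob C) \<longrightarrow>
     has_zero_image A (alt_sum A (OMap T (osum C x n)) {1..n}
       (\<lambda>S. AMap T (msum C (phi C x ({1..n} - S)) n))))"

text \<open>A morphism of the category \<open>\<I>\<close> is a triple of source, target and underlying subset.\<close>

definition Icat :: "(nat, nat \<times> nat \<times> nat set) cat" where
  "Icat = \<lparr>Ob = UNIV, Ar = {(m, n, R). R \<subseteq> {1..min m n}},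
     Dom = (\<lambda>(m, n, R). m), Cod = (\<lambda>(m, n, R). n), Ident = (\<lambda>n. (n, n, {1..n})),
     Comp = (\<lambda>(n, p, R') (m, n', R). (m, p, R' \<inter> R))\<rparr>"

lemma category_Icat: "category Icat"
  by unfold_locales (auto simp: Icat_def homset_def subset_iff)

definition s_fctr ::
    "('o, 'm, 'z) mcat_scheme \<Rightarrow> 'o \<Rightarrow> (nat, nat \<times> nat \<times> nat set, 'o, 'm) fctr" where
  "s_fctr C x = \<lparr>OMap = opow C x,
     AMap = (\<lambda>(m, n, R). msum C (phi C (\<lambda>_. x) R) (min m n)
       \<oplus>\<^sub>m\<^bsub>C\<^esub> zero_mor C (opow C x (m - min m n)) (opow C x (n - min m n)))\<rparr>"

context strict_monoidal_category
begin

lemma homset_objs: "f \<in> homset C a b \<Longrightarrow> a \<in> Ob C \<and> b \<in> Ob C"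
  using dom_closed cod_closed by (auto simp: homset_def)

lemma opow_closed: "x \<in> Ob C \<Longrightarrow> opow C x n \<in> Ob C"
  by (induction n) (auto intro: unit_closed tenso_closed)

lemma opow_add: "x \<in> Ob C \<Longrightarrow> opow C x (m + n) = opow C x m \<oplus>\<^sub>o opow C x n"
  by (induction n) (simp_all add: opow_closed tenso_unit_right tenso_assoc)

context
  assumes null: "is_null C (Unit C)"
begin

lemma to_unit: "a \<in> Ob C \<Longrightarrow> \<exists>!f. f \<in> homset C a (Unit C)"
  and from_unit: "a \<in> Ob C \<Longrightarrow> \<exists>!f. f \<in> homset C (Unit C) a"
  using null by (auto simp: is_null_def is_initial_def is_terminal_def)

lemma zero_mor_eqI:
  assumes "g \<in> homset C a (Unit C)" "h \<in> homset C (Unit C) b"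
  shows "zero_mor C a b = h \<cdot> g"
  unfolding zero_mor_def
proof (rule the_equality)
  show "\<exists>g' \<in> homset C a (Unit C). \<exists>h' \<in> homset C (Unit C) b. h \<cdot> g = h' \<cdot> g'"
    using assms by blast
next
  fix f assume "\<exists>g' \<in> homset C a (Unit C). \<exists>h' \<in> homset C (Unit C) b. f = h' \<cdot> g'"
  then obtain g' h' where "g' \<in> homset C a (Unit C)" "h' \<in> homset C (Unit C) b" "f = h' \<cdot> g'"
    by blast
  moreover from this have "g' = g" "h' = h"
    using to_unit from_unit assms homset_objs by blast+
  ultimately show "f = h \<cdot> g" by simp
qed

lemma zero_morE:
  assumes "a \<in> Ob C" "b \<in> Ob C"
  obtains g h where "g \<in> homset C a (Unit C)" "h \<in> homset C (Unit C) b" "zero_mor C a b = h \<cdot> g"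
  using to_unit[OF assms(1)] from_unit[OF assms(2)] zero_mor_eqI by blast

lemma zero_mor_closed: "a \<in> Ob C \<Longrightarrow> b \<in> Ob C \<Longrightarrow> zero_mor C a b \<in> homset C a b"
  by (metis zero_morE comp_closed)

lemma comp_zero_right:
  assumes "f \<in> homset C b c" "a \<in> Ob C"
  shows "f \<cdot> zero_mor C a b = zero_mor C a c"
proof -
  obtain g h where gh: "g \<in> homset C a (Unit C)" "h \<in> homset C (Unit C) b" "zero_mor C a b = h \<cdot> g"
    using assms homset_objs zero_morE by blast
  then have "zero_mor C a c = (f \<cdot> h) \<cdot> g"
    using assms by (blast intro: zero_mor_eqI comp_closed)
  with gh assms show ?thesis by (simp add: comp_assoc)
qed

lemma comp_zero_left:
  assumes "f \<in> homset C a b" "c \<in> Ob C"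
  shows "zero_mor C b c \<cdot> f = zero_mor C a c"
proof -
  obtain g h where gh: "g \<in> homset C b (Unit C)" "h \<in> homset C (Unit C) c" "zero_mor C b c = h \<cdot> g"
    using assms homset_objs zero_morE by blast
  then have "zero_mor C a c = h \<cdot> (g \<cdot> f)"
    using assms by (blast intro: zero_mor_eqI comp_closed)
  with gh assms show ?thesis by (simp add: comp_assoc)
qed

lemma tensm_zero:
  assumes "a \<in> Ob C" "b \<in> Ob C" "c \<in> Ob C" "d \<in> Ob C"
  shows "zero_mor C a b \<oplus>\<^sub>m zero_mor C c d = zero_mor C (a \<oplus>\<^sub>o c) (b \<oplus>\<^sub>o d)"
proof -
  obtain g h where gh: "g \<in> homset C a (Unit C)" "h \<in> homset C (Unit C) b" "zero_mor C a b = h \<cdot> g"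
    using assms zero_morE by blast
  obtain g' h' where gh': "g' \<in> homset C c (Unit C)" "h' \<in> homset C (Unit C) d"
    "zero_mor C c d = h' \<cdot> g'"
    using assms zero_morE by blast
  have "g \<oplus>\<^sub>m g' \<in> homset C (a \<oplus>\<^sub>o c) (Unit C)" "h \<oplus>\<^sub>m h' \<in> homset C (Unit C) (b \<oplus>\<^sub>o d)"
    using tensm_closed[OF gh(1) gh'(1)] tensm_closed[OF gh(2) gh'(2)]
    by (simp_all add: tenso_unit_left unit_closed)
  then have "zero_mor C (a \<oplus>\<^sub>o c) (b \<oplus>\<^sub>o d) = (h \<oplus>\<^sub>m h') \<cdot> (g \<oplus>\<^sub>m g')"
    by (rule zero_mor_eqI)
  then show ?thesis using gh gh' by (simp add: tensm_comp)
qed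

lemma zero_mor_unit: "zero_mor C (Unit C) (Unit C) = Ident C (Unit C)"
  using zero_mor_eqI[OF id_closed id_closed] id_closed unit_closed comp_id_left by metis

context
  fixes x
  assumes x: "x \<in> Ob C"
begin

lemma phi_closed: "phi C (\<lambda>_. x) R i \<in> homset C x x"
  using x by (simp add: phi_def id_closed zero_mor_closed)

lemma msum_phi_closed: "msum C (phi C (\<lambda>_. x) R) n \<in> homset C (opow C x n) (opow C x n)"
  by (induction n) (auto intro: id_closed unit_closed tensm_closed phi_closed)

lemma msum_phi_comp:
  "msum C (phi C (\<lambda>_. x) R') n \<cdot> msum C (phi C (\<lambda>_. x) R) n = msum C (phi C (\<lambda>_. x) (R' \<inter> R)) n"
proof (induction n)
  case 0
  show ?case using comp_id_left[OF id_closed[OF unit_closed]] by simp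
next
  case (Suc n)
  have "phi C (\<lambda>_. x) R' i \<cdot> phi C (\<lambda>_. x) R i = phi C (\<lambda>_. x) (R' \<inter> R) i" for i
    using x by (auto simp: phi_def comp_zero_right comp_zero_left comp_id_left[OF id_closed]
        id_closed zero_mor_closed)
  with Suc show ?case
    by (simp flip: tensm_comp[OF msum_phi_closed msum_phi_closed phi_closed phi_closed])
qed

lemma msum_phi_id: "{1..n} \<subseteq> R \<Longrightarrow> msum C (phi C (\<lambda>_. x) R) n = Ident C (opow C x n)"
proof (induction n)
  case (Suc n)
  then have "{1..n} \<subseteq> R" "Suc n \<in> R" by auto
  with Suc show ?case by (simp add: phi_def tensm_id opow_closed x)
qed simp

lemma msum_phi_split:
  "\<exists>G \<in> homset C (opow C x d) (opow C x d).
     msum C (phi C (\<lambda>_. x) R) (k + d) = msum C (phi C (\<lambda>_. x) R) k \<oplus>\<^sub>m G \<and>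
     (R \<subseteq> {1..k} \<longrightarrow> G = zero_mor C (opow C x d) (opow C x d))"
proof (induction d)
  case 0
  have "msum C (phi C (\<lambda>_. x) R) k \<in> Ar C"
    using msum_phi_closed[of R k] by (simp add: homset_def)
  then show ?case
    by (intro bexI[of _ "Ident C (Unit C)"])
      (simp_all add: tensm_unit_right zero_mor_unit id_closed unit_closed)
next
  case (Suc d)
  then obtain G where G: "G \<in> homset C (opow C x d) (opow C x d)"
    "msum C (phi C (\<lambda>_. x) R) (k + d) = msum C (phi C (\<lambda>_. x) R) k \<oplus>\<^sub>m G"
    "R \<subseteq> {1..k} \<Longrightarrow> G = zero_mor C (opow C x d) (opow C x d)" by blast
  let ?p = "phi C (\<lambda>_. x) R (Suc (k + d))"
  have ar: "msum C (phi C (\<lambda>_. x) R) k \<in> Ar C" "G \<in> Ar C" "?p \<in> Ar C"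
    using msum_phi_closed[of R k] G(1) phi_closed[of R "Suc (k + d)"] by (simp_all add: homset_def)
  show ?case
  proof (intro bexI[of _ "G \<oplus>\<^sub>m ?p"] conjI impI)
    show "G \<oplus>\<^sub>m ?p \<in> homset C (opow C x (Suc d)) (opow C x (Suc d))"
      using tensm_closed[OF G(1) phi_closed] by simp
    show "msum C (phi C (\<lambda>_. x) R) (k + Suc d) = msum C (phi C (\<lambda>_. x) R) k \<oplus>\<^sub>m (G \<oplus>\<^sub>m ?p)"
      using G(2) tensm_assoc[OF ar] by simp
  next
    assume R: "R \<subseteq> {1..k}"
    then have "?p = zero_mor C x x" by (auto simp: phi_def)
    with G(3)[OF R] show "G \<oplus>\<^sub>m ?p = zero_mor C (opow C x (Suc d)) (opow C x (Suc d))"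
      by (simp add: tensm_zero opow_closed x)
  qed
qed

lemma s_fctr_split:
  assumes "k \<le> min m n"
  obtains H where "H \<in> homset C (opow C x (m - k)) (opow C x (n - k))"
    "AMap (s_fctr C x) (m, n, R) = msum C (phi C (\<lambda>_. x) R) k \<oplus>\<^sub>m H"
    "R \<subseteq> {1..k} \<Longrightarrow> H = zero_mor C (opow C x (m - k)) (opow C x (n - k))"
proof -
  define d where "d = min m n - k"
  define a where "a = m - min m n"
  define b where "b = n - min m n"
  have eqs: "min m n = k + d" "m - k = d + a" "n - k = d + b"
    using assms by (auto simp: d_def a_def b_def)
  obtain G where G: "G \<in> homset C (opow C x d) (opow C x d)"
    "msum C (phi C (\<lambda>_. x) R) (k + d) = msum C (phi C (\<lambda>_. x) R) k \<oplus>\<^sub>m G"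
    "R \<subseteq> {1..k} \<Longrightarrow> G = zero_mor C (opow C x d) (opow C x d)"
    using msum_phi_split by blast
  let ?z = "zero_mor C (opow C x a) (opow C x b)"
  have z: "?z \<in> homset C (opow C x a) (opow C x b)"
    by (simp add: zero_mor_closed opow_closed x)
  have ar: "msum C (phi C (\<lambda>_. x) R) k \<in> Ar C" "G \<in> Ar C" "?z \<in> Ar C"
    using msum_phi_closed[of R k] G(1) z by (simp_all add: homset_def)
  show thesis
  proof
    show "G \<oplus>\<^sub>m ?z \<in> homset C (opow C x (m - k)) (opow C x (n - k))"
      using tensm_closed[OF G(1) z] by (simp add: eqs opow_add x)
    show "AMap (s_fctr C x) (m, n, R) = msum C (phi C (\<lambda>_. x) R) k \<oplus>\<^sub>m (G \<oplus>\<^sub>m ?z)"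
      using G(2) tensm_assoc[OF ar] by (simp add: s_fctr_def a_def b_def eqs(1))
    show "G \<oplus>\<^sub>m ?z = zero_mor C (opow C x (m - k)) (opow C x (n - k))" if "R \<subseteq> {1..k}"
      using G(3)[OF that] by (simp add: tensm_zero eqs opow_add opow_closed x)
  qed
qed

lemma s_fctr_closed: "AMap (s_fctr C x) (m, n, R) \<in> homset C (opow C x m) (opow C x n)"
proof -
  obtain H where H: "H \<in> homset C (opow C x (m - min m n)) (opow C x (n - min m n))"
    "AMap (s_fctr C x) (m, n, R) = msum C (phi C (\<lambda>_. x) R) (min m n) \<oplus>\<^sub>m H"
    using s_fctr_split by blast
  then have "AMap (s_fctr C x) (m, n, R) \<in> homset C
      (opow C x (min m n) \<oplus>\<^sub>o opow C x (m - min m n)) (opow C x (min m n) \<oplus>\<^sub>o opow C x (n - min m n))"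
    by (simp add: tensm_closed msum_phi_closed)
  then show ?thesis using x by (simp flip: opow_add)
qed

lemma s_fctr_comp:
  assumes R: "R \<subseteq> {1..min m n}" and R': "R' \<subseteq> {1..min n p}"
  shows "AMap (s_fctr C x) (n, p, R') \<cdot> AMap (s_fctr C x) (m, n, R) = AMap (s_fctr C x) (m, p, R' \<inter> R)"
proof -
  define k where "k = min (min m n) p"
  have k: "k \<le> min m n" "k \<le> min n p" "k \<le> min m p" by (auto simp: k_def)
  obtain H where H: "H \<in> homset C (opow C x (m - k)) (opow C x (n - k))"
    "AMap (s_fctr C x) (m, n, R) = msum C (phi C (\<lambda>_. x) R) k \<oplus>\<^sub>m H"
    "R \<subseteq> {1..k} \<Longrightarrow> H = zero_mor C (opow C x (m - k)) (opow C x (n - k))"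
    using s_fctr_split[OF k(1), where R = R] by blast
  obtain H' where H': "H' \<in> homset C (opow C x (n - k)) (opow C x (p - k))"
    "AMap (s_fctr C x) (n, p, R') = msum C (phi C (\<lambda>_. x) R') k \<oplus>\<^sub>m H'"
    "R' \<subseteq> {1..k} \<Longrightarrow> H' = zero_mor C (opow C x (n - k)) (opow C x (p - k))"
    using s_fctr_split[OF k(2), where R = R'] by blast
  obtain K where "K \<in> homset C (opow C x (m - k)) (opow C x (p - k))" and K:
    "AMap (s_fctr C x) (m, p, R' \<inter> R) = msum C (phi C (\<lambda>_. x) (R' \<inter> R)) k \<oplus>\<^sub>m K"
    "R' \<inter> R \<subseteq> {1..k} \<Longrightarrow> K = zero_mor C (opow C x (m - k)) (opow C x (p - k))"
    using s_fctr_split[OF k(3), where R = "R' \<inter> R"] by blast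
  have "R' \<inter> R \<subseteq> {1..k}" "R \<subseteq> {1..k} \<or> R' \<subseteq> {1..k}"
    using R R' unfolding k_def by (auto simp: subset_iff) (meson le_trans linear)
  then have "H' \<cdot> H = K"
    using H(1,3) H'(1,3) K(2) by (auto simp: comp_zero_left comp_zero_right opow_closed x)
  then show ?thesis
    using tensm_comp[OF msum_phi_closed msum_phi_closed H(1) H'(1)] H(2) H'(2) K(1)
    by (simp add: msum_phi_comp)
qed

lemma s_fctr_id: "AMap (s_fctr C x) (n, n, {1..n}) = Ident C (opow C x n)"
proof -
  have "Ident C (opow C x n) \<in> Ar C"
    using id_closed[OF opow_closed[OF x]] by (simp add: homset_def)
  then show ?thesis
    by (simp add: s_fctr_def msum_phi_id zero_mor_unit tensm_unit_right)
qed

lemma cat_functor_s_fctr: "cat_functor Icat C (s_fctr C x)"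
proof -
  interpret I: category Icat by (rule category_Icat)
  have O: "OMap (s_fctr C x) = opow C x" by (simp add: s_fctr_def)
  show ?thesis
  proof
    fix a assume "a \<in> Ob Icat"
    show "OMap (s_fctr C x) a \<in> Ob C" by (simp add: O opow_closed x)
    show "AMap (s_fctr C x) (Ident Icat a) = Ident C (OMap (s_fctr C x) a)"
      using s_fctr_id[of a] by (simp add: O Icat_def)
  next
    fix f a b assume "f \<in> homset Icat a b"
    then obtain R where "f = (a, b, R)" by (auto simp: homset_def Icat_def)
    then show "AMap (s_fctr C x) f \<in> homset C (OMap (s_fctr C x) a) (OMap (s_fctr C x) b)"
      by (simp add: O s_fctr_closed)
  next
    fix f a b g c assume "f \<in> homset Icat a b" "g \<in> homset Icat b c"
    then obtain R R' where "f = (a, b, R)" "R \<subseteq> {1..min a b}" "g = (b, c, R')" "R' \<subseteq> {1..min b c}"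
      by (auto simp: homset_def Icat_def)
    then show "AMap (s_fctr C x) (g \<cdot>\<^bsub>Icat\<^esub> f) = AMap (s_fctr C x) g \<cdot> AMap (s_fctr C x) f"
      using s_fctr_comp[of R a b R' c] by (simp add: Icat_def)
  qed
qed

end

end

end

definition f_mor :: "nat \<Rightarrow> nat set \<Rightarrow> nat \<times> nat \<times> nat set" where
  "f_mor m Q = (m, m, {1..m} - Q)"

definition ht_I ::
    "('o, 'm, 'y) mcat_scheme \<Rightarrow> 'o \<Rightarrow> ('p, 'n, 'z) acat_scheme \<Rightarrow> ('o, 'm, 'p, 'n) fctr \<Rightarrow> ereal" where
  "ht_I C x A T = height (\<lambda>n. \<forall>m \<ge> n.
     has_zero_image A (alt_sum A (OMap (fcomp T (s_fctr C x)) m) {m - n + 1..m}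
       (\<lambda>S. AMap (fcomp T (s_fctr C x)) (f_mor m (S \<union> {1..m - n})))))"

end

theory Submission
  imports Defs
begin

text \<open>
  Having zero image means being zero. For a set \<open>U\<close> of coordinates of \<open>x\<^bsup>\<oplus>N\<^esup>\<close>, the alternating sum
  of \<open>T(\<phi>\<^sub>V)\<close> over \<open>V \<subseteq> U\<close> is the alternating sum of the constant tuple \<open>(x, \<dots>, x)\<close> of length
  \<open>card U\<close>, conjugated along a retraction of \<open>x\<^bsup>\<oplus>N\<^esup>\<close> onto \<open>x\<^bsup>\<oplus>card U\<^esup>\<close>. So both
  height conditions on constant tuples agree. An arbitrary tuple is isomorphic to one of powers of
  \<open>x\<close>, that is, to a partition of \<open>{1..N}\<close> into blocks; by Moebius inversion its alternating sum is
  the sum of those attached to the sets \<open>U\<close> that meet every block, and such a \<open>U\<close> has at least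
  as many elements as there are blocks.
\<close>

section \<open>Alternating sums over subsets\<close>

text \<open>A nonempty finite set has as many subsets of even as of odd size.\<close>

lemma sum_Pow_alternating:
  assumes "finite X"
  shows "(\<Sum>S\<in>Pow X. (-1) ^ card S) = (if X = {} then 1 else 0 :: int)"
proof (cases "X = {}")
  case False
  then have "card {S. S \<subseteq> X \<and> {} \<subseteq> S \<and> even (card S)} = card {S. S \<subseteq> X \<and> {} \<subseteq> S \<and> odd (card S)}"
    using assms by (intro card_subsupersets_even_odd) auto
  then have "(\<Sum>S\<in>Pow X. (-1) ^ card S) = (0 :: int)"
    using assms by (intro sum_alternating_cancels) (simp_all add: Pow_def)
  with False show ?thesis by simp
qed simp

text \<open>Moebius inversion on the lattice of subsets: removing \<open>V\<close> turns the
  interval from \<open>V\<close> to \<open>W\<close> into the power set of \<open>W - V\<close>, and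
  the interval is empty unless \<open>V \<subseteq> W\<close>.\<close>

lemma sum_interval_alternating:
  assumes "finite W"
  shows "(\<Sum>U | V \<subseteq> U \<and> U \<subseteq> W. (-1) ^ card (U - V)) = (if V = W then 1 else 0 :: int)"
proof (cases "V \<subseteq> W")
  case True
  have "(\<Sum>U | V \<subseteq> U \<and> U \<subseteq> W. (-1) ^ card (U - V)) = (\<Sum>Q\<in>Pow (W - V). (-1) ^ card Q :: int)"
    using True by (intro sum.reindex_bij_witness[of _ "\<lambda>Q. V \<union> Q" "\<lambda>U. U - V"]) auto
  also have "\<dots> = (if V = W then 1 else 0)"
    using sum_Pow_alternating[of "W - V"] assms True by auto
  finally show ?thesis .
next
  case False
  then have "{U. V \<subseteq> U \<and> U \<subseteq> W} = {}" "V \<noteq> W" by auto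
  then show ?thesis by (simp del: Collect_empty_eq)
qed

text \<open>The exponents of \<open>g V\<close> on both sides of the expansion of a blockwise alternating product
  into elementwise ones: only the sets \<open>U\<close> meeting every block survive.\<close>

lemma sum_alternating_fibres:
  assumes "finite N" "finite I" "t ` N \<subseteq> I" "V \<subseteq> N"
  shows "(\<Sum>S\<in>Pow I. if V = {j \<in> N. t j \<notin> S} then (-1) ^ card S else 0) =
    (\<Sum>U | U \<subseteq> N \<and> t ` U = I. if V \<subseteq> U then (-1) ^ card (U - V) else 0 :: int)"
proof -
  let ?w = "\<lambda>U. (-1) ^ card (U - V) :: int"
  let ?D = "{U. V \<subseteq> U \<and> U \<subseteq> N}"
  have finD: "finite ?D" using assms(1) by simp
  \<comment> \<open>The indicator of \<open>V = {j \<in> N. t j \<notin> S}\<close> is expanded by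
    Moebius inversion.\<close>
  have "(\<Sum>S\<in>Pow I. if V = {j \<in> N. t j \<notin> S} then (-1) ^ card S else 0) =
      (\<Sum>S\<in>Pow I. \<Sum>U | V \<subseteq> U \<and> U \<subseteq> {j \<in> N. t j \<notin> S}. (-1) ^ card S * ?w U)"
    using assms(1) by (intro sum.cong) (simp_all add: sum_interval_alternating flip: sum_distrib_left)
  \<comment> \<open>For \<open>U \<subseteq> N\<close>, the upper bound on \<open>U\<close> says
    that the image of \<open>U\<close> under \<open>t\<close> avoids \<open>S\<close>. Padding with
    zeros makes the range of \<open>U\<close> independent of \<open>S\<close>, so that the sums can
    be swapped.\<close>
  also have "\<dots> = (\<Sum>S\<in>Pow I. \<Sum>U\<in>?D. if S \<inter> t ` U = {} then (-1) ^ card S * ?w U else 0)"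
    using finD by (intro sum.cong sum.mono_neutral_cong_left) auto
  also have "\<dots> = (\<Sum>U\<in>?D. \<Sum>S\<in>Pow I. if S \<inter> t ` U = {} then (-1) ^ card S * ?w U else 0)"
    by (rule sum.swap)
  \<comment> \<open>Now \<open>S\<close> runs over the sets of blocks that \<open>U\<close> misses;
    their alternating sum vanishes unless \<open>U\<close> meets every block.\<close>
  also have "\<dots> = (\<Sum>U\<in>?D. \<Sum>S\<in>Pow (I - t ` U). (-1) ^ card S * ?w U)"
    using assms(2) by (intro sum.cong sum.mono_neutral_cong_right) auto
  also have "\<dots> = (\<Sum>U\<in>?D. if t ` U = I then ?w U else 0)"
  proof (intro sum.cong refl)
    fix U assume "U \<in> ?D"
    then have "t ` U \<subseteq> I" using assms(3) by auto
    then show "(\<Sum>S\<in>Pow (I - t ` U). (-1) ^ card S * ?w U) = (if t ` U = I then ?w U else 0)"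
      using sum_Pow_alternating[of "I - t ` U"] assms(2) by (auto simp flip: sum_distrib_right)
  qed
  also have "\<dots> = (\<Sum>U | U \<subseteq> N \<and> t ` U = I. if V \<subseteq> U then ?w U else 0)"
    using assms(1) by (intro sum.mono_neutral_cong) auto
  finally show ?thesis .
qed

section \<open>Rearranging finite products of integer powers\<close>

context comm_group
begin

lemma finprod_pow_sum:
  assumes "finite J" "g \<in> P \<rightarrow> carrier G"
  shows "(\<Otimes>v\<in>P. g v [^] (\<Sum>j\<in>J. a j v :: int)) = (\<Otimes>j\<in>J. \<Otimes>v\<in>P. g v [^] a j v)"
  using assms(1)
proof (induction J)
  case (insert j J)
  have "(\<Otimes>v\<in>P. g v [^] (\<Sum>j\<in>insert j J. a j v)) = (\<Otimes>v\<in>P. g v [^] a j v \<otimes> g v [^] (\<Sum>j\<in>J. a j v))"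
    using insert.hyps assms(2) by (intro finprod_cong') (auto simp: int_pow_mult Pi_def)
  also have "\<dots> = (\<Otimes>v\<in>P. g v [^] a j v) \<otimes> (\<Otimes>v\<in>P. g v [^] (\<Sum>j\<in>J. a j v))"
    using assms(2) by (intro finprod_multf) auto
  also have "\<dots> = (\<Otimes>j\<in>insert j J. \<Otimes>v\<in>P. g v [^] a j v)"
  proof -
    have "(\<Otimes>v\<in>P. g v [^] a i v) \<in> carrier G" for i
      using assms(2) by (intro finprod_closed) auto
    then show ?thesis using insert by simp
  qed
  finally show ?case .
qed simp

text \<open>Equal factors are collected: the exponent of \<open>g v\<close> is the total of
  \<open>e\<close> over the fibre of \<open>h\<close> above \<open>v\<close>. Once that sum is
  split, the product for each single \<open>j\<close> has at most one nontrivial factor, at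
  \<open>v = h j\<close>.\<close>

lemma finprod_pow_fibre:
  assumes "finite P" "finite J" "g \<in> P \<rightarrow> carrier G" "h \<in> J \<rightarrow> P"
  shows "(\<Otimes>v\<in>P. g v [^] (\<Sum>j\<in>J. if v = h j then e j else 0 :: int)) = (\<Otimes>j\<in>J. g (h j) [^] e j)"
proof -
  have "(\<Otimes>v\<in>P. g v [^] (if v = h j then e j else 0)) = g (h j) [^] e j" if "j \<in> J" for j
  proof -
    have "(\<Otimes>v\<in>P. g v [^] (if v = h j then e j else 0)) = (\<Otimes>v\<in>P. if v = h j then g v [^] e j else \<one>)"
      using assms(3) by (intro finprod_cong') (auto simp: Pi_def)
    also have "\<dots> = g (h j) [^] e j"
      using that assms by (intro finprod_singleton_swap) (auto simp: Pi_def)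
    finally show ?thesis .
  qed
  moreover have "g (h j) [^] e j \<in> carrier G" if "j \<in> J" for j
    using that assms by (auto simp: Pi_def)
  ultimately show ?thesis
    using assms by (subst finprod_pow_sum) (auto intro: finprod_cong')
qed

text \<open>By \<open>sum_alternating_fibres\<close> the blockwise product is the product, over all
  \<open>U\<close> meeting every block, of the elementwise alternating products for
  \<open>U\<close>. In the application \<open>t\<close> sends a coordinate to its block and
  \<open>g V\<close> is \<open>T\<close> of the projection onto the coordinates in
  \<open>V\<close>.\<close>

lemma alternating_finprod_fibres:
  assumes fin: "finite N" "finite I" and t: "t ` N \<subseteq> I" and g: "g \<in> Pow N \<rightarrow> carrier G"
    and one: "\<And>U. U \<subseteq> N \<Longrightarrow> t ` U = I \<Longrightarrow> (\<Otimes>S\<in>Pow U. g (U - S) [^] ((-1) ^ card S :: int)) = \<one>"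
  shows "(\<Otimes>S\<in>Pow I. g {j \<in> N. t j \<notin> S} [^] ((-1) ^ card S :: int)) = \<one>"
proof -
  let ?A = "{U. U \<subseteq> N \<and> t ` U = I}"
  let ?c = "\<lambda>U V. if V \<subseteq> U then (-1) ^ card (U - V) else 0 :: int"
  have "(\<Otimes>S\<in>Pow I. g {j \<in> N. t j \<notin> S} [^] ((-1) ^ card S :: int)) =
      (\<Otimes>V\<in>Pow N. g V [^] (\<Sum>S\<in>Pow I. if V = {j \<in> N. t j \<notin> S} then (-1) ^ card S else 0 :: int))"
    using fin g by (intro finprod_pow_fibre[symmetric]) auto
  also have "\<dots> = (\<Otimes>V\<in>Pow N. g V [^] (\<Sum>U\<in>?A. ?c U V))"
    using g sum_alternating_fibres[OF fin t] by (intro finprod_cong') auto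
  also have "\<dots> = (\<Otimes>U\<in>?A. \<Otimes>V\<in>Pow N. g V [^] ?c U V)"
    using fin g by (intro finprod_pow_sum) auto
  also have "\<dots> = \<one>"
  proof (rule finprod_one_eqI)
    fix U assume U: "U \<in> ?A"
    have finU: "finite U" using U fin(1) finite_subset by blast
    \<comment> \<open>The only \<open>S \<subseteq> U\<close> that can satisfy
      \<open>V = U - S\<close> is \<open>U - V\<close>. Writing the exponent as a sum over the fibre
      of \<open>S \<mapsto> U - S\<close> prepares for \<open>finprod_pow_fibre\<close>.\<close>
    have c: "?c U V = (\<Sum>S\<in>Pow U. if V = U - S then (-1) ^ card S else 0)" for V
    proof -
      have "(\<Sum>S\<in>Pow U. if V = U - S then (-1) ^ card S else 0) =
          (\<Sum>S\<in>Pow U. if S = U - V then ?c U V else 0)"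
      proof (intro sum.cong refl)
        fix S assume "S \<in> Pow U"
        then have "V = U - S \<longleftrightarrow> V \<subseteq> U \<and> S = U - V" by blast
        then show "(if V = U - S then (-1) ^ card S else 0) = (if S = U - V then ?c U V else 0)"
          by simp
      qed
      also have "\<dots> = ?c U V" using finU by simp
      finally show ?thesis by simp
    qed
    have "(\<Otimes>V\<in>Pow N. g V [^] ?c U V) = (\<Otimes>S\<in>Pow U. g (U - S) [^] ((-1) ^ card S :: int))"
      unfolding c using fin g U finU by (intro finprod_pow_fibre) auto
    with U one show "(\<Otimes>V\<in>Pow N. g V [^] ?c U V) = \<one>" by simp
  qed
  finally show ?thesis .
qed

end

section \<open>Vanishing in abelian categories\<close>

lemma finprod_hom:
  assumes "comm_group G" "comm_group H" "\<phi> \<in> hom G H" "f \<in> X \<rightarrow> carrier G"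
  shows "\<phi> (finprod G f X) = finprod H (\<lambda>v. \<phi> (f v)) X"
proof -
  interpret G: comm_group G by fact
  interpret H: comm_group H by fact
  interpret group_hom G H \<phi>
    using assms(3) by unfold_locales
  show ?thesis
    using assms(4)
  proof (induction X rule: infinite_finite_induct)
    case (insert v X)
    then have "f \<in> X \<rightarrow> carrier G" "f v \<in> carrier G" by auto
    with insert show ?case by (simp add: Pi_def)
  qed simp_all
qed

lemma (in category) homset_Ob:
  assumes "f \<in> homset C a b"
  shows "a \<in> Ob C" "b \<in> Ob C"
  using assms dom_closed cod_closed by (auto simp: homset_def)

section \<open>Zero morphisms, null objects and zero images\<close>

context abelian_category
begin

lemma hom_group_simps [simp]:
  "carrier (hom_group A a b) = homset A a b"
  "mult (hom_group A a b) = AddM A"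
  "one (hom_group A a b) = ZeroM A a b"
  by (simp_all add: hom_group_def)

lemma ZeroM_closed: "a \<in> Ob A \<Longrightarrow> b \<in> Ob A \<Longrightarrow> ZeroM A a b \<in> homset A a b"
  using monoid.one_closed[OF group.is_monoid[OF comm_group.axioms(2)[OF hom_comm_group]], of a b] by simp

lemma hom_pow_closed:
  assumes "f \<in> homset A a b"
  shows "f [^]\<^bsub>hom_group A a b\<^esub> (k :: int) \<in> homset A a b"
  using group.int_pow_closed[OF comm_group.axioms(2)[OF hom_comm_group], of a b f k] assms homset_Ob
  by simp

text \<open>The neutral element is the only idempotent of a group. This derives the absorption laws
  for zero from bilinearity of composition.\<close>

lemma ZeroM_eqI:
  assumes "f \<in> homset A a b" "AddM A f f = f"
  shows "f = ZeroM A a b"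
proof -
  interpret comm_group "hom_group A a b"
    using assms(1) homset_Ob by (blast intro: hom_comm_group)
  show ?thesis using l_cancel_one[of f f] assms by simp
qed

lemma AddM_ZeroM: "a \<in> Ob A \<Longrightarrow> b \<in> Ob A \<Longrightarrow> AddM A (ZeroM A a b) (ZeroM A a b) = ZeroM A a b"
  using monoid.l_one[OF group.is_monoid[OF comm_group.axioms(2)[OF hom_comm_group]], of a b] ZeroM_closed
  by simp

lemma comp_ZeroM_right:
  assumes "g \<in> homset A b c" "a \<in> Ob A"
  shows "g \<cdot> ZeroM A a b = ZeroM A a c"
proof (rule ZeroM_eqI)
  have z: "ZeroM A a b \<in> homset A a b" using assms homset_Ob by (blast intro: ZeroM_closed)
  then show "g \<cdot> ZeroM A a b \<in> homset A a c" using assms comp_closed by blast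
  show "AddM A (g \<cdot> ZeroM A a b) (g \<cdot> ZeroM A a b) = g \<cdot> ZeroM A a b"
    using comp_add_right[OF z z assms(1)] AddM_ZeroM[of a b] assms homset_Ob(1)[OF assms(1)] by simp
qed

lemma comp_ZeroM_left:
  assumes "f \<in> homset A a b" "c \<in> Ob A"
  shows "ZeroM A b c \<cdot> f = ZeroM A a c"
proof (rule ZeroM_eqI)
  have z: "ZeroM A b c \<in> homset A b c" using assms homset_Ob by (blast intro: ZeroM_closed)
  then show "ZeroM A b c \<cdot> f \<in> homset A a c" using assms comp_closed by blast
  show "AddM A (ZeroM A b c \<cdot> f) (ZeroM A b c \<cdot> f) = ZeroM A b c \<cdot> f"
    using comp_add_left[OF assms(1) z z] AddM_ZeroM[of b c] assms homset_Ob(2)[OF assms(1)] by simp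
qed

text \<open>A morphism into or out of \<open>a\<close> is unchanged by composition with the identity
  of \<open>a\<close>, hence is zero.\<close>

lemma is_null_if_Ident_eq_ZeroM:
  assumes "a \<in> Ob A" "Ident A a = ZeroM A a a"
  shows "is_null A a"
proof -
  have "f = ZeroM A a b" if "f \<in> homset A a b" for f b
    using that comp_id_right[OF that] comp_ZeroM_right[OF that assms(1)] assms(2) by simp
  moreover have "f = ZeroM A b a" if "f \<in> homset A b a" for f b
    using that comp_id_left[OF that] comp_ZeroM_left[OF that assms(1)] assms(2) by simp
  ultimately show ?thesis
    using assms(1) ZeroM_closed unfolding is_null_def is_initial_def is_terminal_def by metis
qed

text \<open>A morphism factors through its image, so it is zero if the image object is null.
  Conversely, the cokernel of a zero morphism has a left inverse, so its kernel, which is the image,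
  has null source.\<close>

lemma has_zero_image_iff:
  assumes f: "f \<in> homset A a b"
  shows "has_zero_image A f \<longleftrightarrow> f = ZeroM A a b"
proof
  have ab: "a \<in> Ob A" "b \<in> Ob A" using homset_Ob[OF f] by auto
  have fA: "f \<in> Ar A" "Dom A f = a" "Cod A f = b" using f by (auto simp: homset_def)
  {
    assume "has_zero_image A f"
    then obtain i q where q: "is_cokernel A q f" and i: "is_kernel A i q" and n: "is_null A (Dom A i)"
      unfolding has_zero_image_def is_image_def by blast
    from i have iA: "i \<in> homset A (Dom A i) (Dom A q)" by (simp add: is_kernel_def homset_def)
    have "q \<cdot> f = ZeroM A (Dom A f) (Cod A q)" "Dom A q = b"
      using q fA by (auto simp: is_cokernel_def)
    then obtain h where h: "h \<in> homset A a (Dom A i)" "i \<cdot> h = f"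
      using i fA unfolding is_kernel_def by metis
    have "i = ZeroM A (Dom A i) b"
      using n iA ZeroM_closed[of "Dom A i" b] ab homset_Ob(1)[OF iA] \<open>Dom A q = b\<close>
      unfolding is_null_def is_initial_def by blast
    then show "f = ZeroM A a b" using comp_ZeroM_left[OF h(1) ab(2)] h(2) by simp
  }
  {
    assume f0: "f = ZeroM A a b"
    obtain q where q: "is_cokernel A q f" using ex_cokernel fA by blast
    then have qA: "q \<in> homset A b (Cod A q)" using fA by (auto simp: is_cokernel_def homset_def)
    obtain i where i: "is_kernel A i q" using ex_kernel qA by (auto simp: homset_def)
    define c where "c = Dom A i"
    have iA: "i \<in> homset A c b" using i qA by (auto simp: is_kernel_def homset_def c_def)
    have c: "c \<in> Ob A" using homset_Ob[OF iA] by simp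
    \<comment> \<open>Since \<open>f\<close> is zero, the identity of \<open>b\<close> kills it and
      therefore factors through the cokernel \<open>q\<close>; this yields the left inverse
      \<open>h\<close> of \<open>q\<close>.\<close>
    have "Ident A b \<in> homset A b b" using id_closed ab by blast
    moreover have "Ident A b \<cdot> f = ZeroM A a b" using comp_id_left[OF f] f0 by simp
    moreover from calculation(1) have "Ident A b \<in> Ar A" "Dom A (Ident A b) = b" "Cod A (Ident A b) = b"
      by (auto simp: homset_def)
    ultimately obtain h where h: "h \<in> homset A (Cod A q) b" "h \<cdot> q = Ident A b"
      using q fA unfolding is_cokernel_def by metis
    have qi: "q \<cdot> i = ZeroM A c (Cod A q)" using i by (simp add: is_kernel_def c_def)
    have "i = (h \<cdot> q) \<cdot> i" using h comp_id_left[OF iA] by simp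
    also have "\<dots> = ZeroM A c b"
      using comp_assoc[OF iA qA h(1)] qi comp_ZeroM_right[OF h(1) c] by simp
    finally have i0: "i = ZeroM A c b" .
    \<comment> \<open>As \<open>i\<close> is zero, both the identity and the zero endomorphism of
      \<open>c\<close> lift \<open>i\<close> through itself; uniqueness identifies them.\<close>
    have "\<exists>!h. h \<in> homset A c c \<and> i \<cdot> h = i"
      using i unfolding is_kernel_def c_def by blast
    moreover have "i \<cdot> Ident A c = i" "i \<cdot> ZeroM A c c = i"
      using comp_id_right[OF iA] comp_ZeroM_right[OF iA c] i0 by simp_all
    ultimately have "Ident A c = ZeroM A c c"
      using id_closed[OF c] ZeroM_closed[OF c c] by blast
    then show "has_zero_image A f"
      using is_null_if_Ident_eq_ZeroM[OF c] q i
      unfolding has_zero_image_def is_image_def c_def by blast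
  }
qed

section \<open>Alternating sums of endomorphisms\<close>

lemma alt_sum_closed:
  assumes "a \<in> Ob A" "F \<in> Pow U \<rightarrow> homset A a a"
  shows "alt_sum A a U F \<in> homset A a a"
proof -
  interpret comm_group "hom_group A a a" using assms by (simp add: hom_comm_group)
  show ?thesis
    unfolding alt_sum_def hom_group_simps(1)[symmetric]
    using assms(2) by (intro finprod_closed) (auto simp: Pi_def intro!: hom_pow_closed)
qed

lemma alt_sum_cong:
  assumes "a \<in> Ob A" "\<And>S. S \<subseteq> U \<Longrightarrow> F S = F' S" "F' \<in> Pow U \<rightarrow> homset A a a"
  shows "alt_sum A a U F = alt_sum A a U F'"
proof -
  interpret comm_group "hom_group A a a" using assms by (simp add: hom_comm_group)
  show ?thesis
    unfolding alt_sum_def using assms(2,3) by (intro finprod_cong') (auto simp: Pi_def intro!: hom_pow_closed)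
qed

text \<open>Taking images under a bijection permutes the index sets and preserves their cardinality,
  hence the signs.\<close>

lemma alt_sum_reindex:
  assumes "a \<in> Ob A" "F \<in> Pow U' \<rightarrow> homset A a a" "bij_betw \<rho> U U'"
  shows "alt_sum A a U' F = alt_sum A a U (\<lambda>S. F (\<rho> ` S))"
proof -
  interpret comm_group "hom_group A a a" using assms by (simp add: hom_comm_group)
  have "bij_betw ((`) \<rho>) (Pow U) (Pow U')" using assms(3) by (rule bij_betw_Pow)
  then have b: "inj_on ((`) \<rho>) (Pow U)" "(`) \<rho> ` Pow U = Pow U'"
    by (auto simp: bij_betw_def)
  have cl: "F S [^]\<^bsub>hom_group A a a\<^esub> (k :: int) \<in> carrier (hom_group A a a)" if "S \<in> Pow U'" for S k
    unfolding hom_group_simps using hom_pow_closed funcset_mem[OF assms(2) that] by blast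
  have "alt_sum A a U' F = finprod (hom_group A a a)
      (\<lambda>S. F (\<rho> ` S) [^]\<^bsub>hom_group A a a\<^esub> ((-1) ^ card (\<rho> ` S) :: int)) (Pow U)"
    unfolding alt_sum_def b(2)[symmetric]
    by (rule finprod_reindex[OF _ b(1)]) (unfold b(2), rule funcsetI, erule cl)
  also have "\<dots> = alt_sum A a U (\<lambda>S. F (\<rho> ` S))"
    unfolding alt_sum_def
  proof (intro finprod_cong' funcsetI)
    fix S assume S: "S \<in> Pow U"
    then have "card (\<rho> ` S) = card S"
      using assms(3) by (meson PowD bij_betw_def card_image inj_on_subset)
    then show "F (\<rho> ` S) [^]\<^bsub>hom_group A a a\<^esub> ((-1) ^ card (\<rho> ` S) :: int) =
        F (\<rho> ` S) [^]\<^bsub>hom_group A a a\<^esub> ((-1) ^ card S :: int)" by simp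
    show "F (\<rho> ` S) [^]\<^bsub>hom_group A a a\<^esub> ((-1) ^ card S :: int) \<in> carrier (hom_group A a a)"
      using S b(2) by (intro cl) blast
  qed simp
  finally show ?thesis .
qed

text \<open>Bilinearity makes \<open>f \<mapsto> h \<cdot> (f \<cdot> k)\<close> a group
  homomorphism, which commutes with finite sums and integer multiples.\<close>

lemma alt_sum_comp:
  assumes h: "h \<in> homset A a b" and k: "k \<in> homset A b a" and F: "F \<in> Pow U \<rightarrow> homset A a a"
  shows "alt_sum A b U (\<lambda>S. h \<cdot> (F S \<cdot> k)) = h \<cdot> (alt_sum A a U F \<cdot> k)"
proof -
  have ab: "a \<in> Ob A" "b \<in> Ob A" using homset_Ob[OF h] by auto
  interpret G: comm_group "hom_group A a a" using ab by (simp add: hom_comm_group)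
  interpret H: comm_group "hom_group A b b" using ab by (simp add: hom_comm_group)
  have hom: "(\<lambda>f. h \<cdot> (f \<cdot> k)) \<in> hom (hom_group A a a) (hom_group A b b)"
  proof (rule homI)
    fix f assume "f \<in> carrier (hom_group A a a)"
    then show "h \<cdot> (f \<cdot> k) \<in> carrier (hom_group A b b)"
      using h k by (auto intro: comp_closed)
  next
    fix f g assume "f \<in> carrier (hom_group A a a)" "g \<in> carrier (hom_group A a a)"
    then have f: "f \<in> homset A a a" and g: "g \<in> homset A a a" by auto
    then have "f \<cdot> k \<in> homset A b a" "g \<cdot> k \<in> homset A b a" using k by (auto intro: comp_closed)
    then show "h \<cdot> ((f \<otimes>\<^bsub>hom_group A a a\<^esub> g) \<cdot> k) =
        (h \<cdot> (f \<cdot> k)) \<otimes>\<^bsub>hom_group A b b\<^esub> (h \<cdot> (g \<cdot> k))"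
      by (simp add: comp_add_left[OF k f g] comp_add_right[OF _ _ h])
  qed
  interpret group_hom "hom_group A a a" "hom_group A b b" "\<lambda>f. h \<cdot> (f \<cdot> k)"
    using hom by unfold_locales
  have closed: "F S \<in> carrier (hom_group A a a)" if "S \<in> Pow U" for S
    using F that by auto
  have "h \<cdot> (alt_sum A a U F \<cdot> k) = finprod (hom_group A b b)
      (\<lambda>S. h \<cdot> ((F S [^]\<^bsub>hom_group A a a\<^esub> ((-1) ^ card S :: int)) \<cdot> k)) (Pow U)"
    unfolding alt_sum_def using closed
    by (intro finprod_hom[OF G.comm_group_axioms H.comm_group_axioms hom]) (simp add: Pi_def hom_pow_closed)
  also have "\<dots> = alt_sum A b U (\<lambda>S. h \<cdot> (F S \<cdot> k))"
    unfolding alt_sum_def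
    using closed hom_int_pow hom_closed
    by (intro H.finprod_cong') (simp_all add: Pi_def hom_pow_closed)
  finally show ?thesis by simp
qed

lemma alt_sum_comp_eq_ZeroM:
  assumes "h \<in> homset A a b" "k \<in> homset A b a" "F \<in> Pow U \<rightarrow> homset A a a"
    and "alt_sum A a U F = ZeroM A a a"
  shows "alt_sum A b U (\<lambda>S. h \<cdot> (F S \<cdot> k)) = ZeroM A b b"
  using alt_sum_comp[OF assms(1-3)] assms(4) comp_ZeroM_left[OF assms(2)] comp_ZeroM_right[OF assms(1)]
    homset_Ob[OF assms(1)] by simp

end

section \<open>Coordinate projections\<close>

text \<open>This is the increasing numbering of \<open>U\<close>. Because
  \<open>0 \<notin> U\<close>, each element of \<open>U\<close> counts itself, so ranks start at
  1.\<close>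

lemma bij_betw_rank:
  fixes U :: "nat set"
  assumes "finite U" "0 \<notin> U"
  shows "bij_betw (\<lambda>j. card (U \<inter> {1..j})) U {1..card U}"
proof -
  let ?r = "\<lambda>j. card (U \<inter> {1..j})"
  have less: "?r i < ?r j" if "j \<in> U" "i < j" for i j
  proof (rule psubset_card_mono)
    have "j \<in> U \<inter> {1..j}" "j \<notin> U \<inter> {1..i}" using that by simp_all
    moreover have "U \<inter> {1..i} \<subseteq> U \<inter> {1..j}" using that(2) by force
    ultimately show "U \<inter> {1..i} \<subset> U \<inter> {1..j}" by blast
  qed simp
  have inj: "inj_on ?r U"
  proof (rule inj_onI)
    fix i j assume "i \<in> U" "j \<in> U" "?r i = ?r j"
    then show "i = j" using less[of j i] less[of i j] by (cases i j rule: linorder_cases) simp_all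
  qed
  have "?r ` U \<subseteq> {1..card U}"
  proof (rule image_subsetI)
    fix j assume j: "j \<in> U"
    then have "0 < j" using assms(2) by (cases j) simp_all
    then have "?r j \<ge> 1" using less[OF j, of 0] by linarith
    moreover have "?r j \<le> card U" using assms(1) by (simp add: card_mono)
    ultimately show "?r j \<in> {1..card U}" by simp
  qed
  moreover have "card (?r ` U) = card {1..card U}" using card_image[OF inj] by simp
  ultimately have "?r ` U = {1..card U}" by (intro card_subset_eq) simp_all
  with inj show ?thesis unfolding bij_betw_def by blast
qed

abbreviation coord_proj :: "('o, 'm, 'z) mcat_scheme \<Rightarrow> 'o \<Rightarrow> nat set \<Rightarrow> nat \<Rightarrow> 'm" where
  "coord_proj C x V n \<equiv> msum C (phi C (\<lambda>_. x) V) n"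

section \<open>Iterated sums of objects and morphisms\<close>

context strict_monoidal_category
begin

lemma osum_closed: "(\<And>i. i \<in> {1..n} \<Longrightarrow> y i \<in> Ob C) \<Longrightarrow> osum C y n \<in> Ob C"
  by (induction n) (simp_all add: unit_closed tenso_closed)

lemma msum_closed:
  "(\<And>i. i \<in> {1..n} \<Longrightarrow> f i \<in> homset C (y i) (z i)) \<Longrightarrow> msum C f n \<in> homset C (osum C y n) (osum C z n)"
  by (induction n) (simp_all add: unit_closed id_closed tensm_closed)

lemma msum_cong: "(\<And>i. i \<in> {1..n} \<Longrightarrow> f i = g i) \<Longrightarrow> msum C f n = msum C g n"
  by (induction n) simp_all

lemma msum_comp:
  assumes "\<And>i. i \<in> {1..n} \<Longrightarrow> f i \<in> homset C (y i) (z i)" "\<And>i. i \<in> {1..n} \<Longrightarrow> g i \<in> homset C (z i) (w i)"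
  shows "msum C (\<lambda>i. g i \<cdot> f i) n = msum C g n \<cdot> msum C f n"
  using assms
proof (induction n)
  case 0
  show ?case using comp_id_left[OF id_closed[OF unit_closed]] by simp
next
  case (Suc n)
  have "msum C (\<lambda>i. g i \<cdot> f i) n = msum C g n \<cdot> msum C f n"
    by (rule Suc.IH) (use Suc.prems in simp_all)
  moreover have "msum C f n \<in> homset C (osum C y n) (osum C z n)" "msum C g n \<in> homset C (osum C z n) (osum C w n)"
    by (rule msum_closed, use Suc.prems in simp)+
  moreover have "f (Suc n) \<in> homset C (y (Suc n)) (z (Suc n))" "g (Suc n) \<in> homset C (z (Suc n)) (w (Suc n))"
    using Suc.prems by simp_all
  ultimately show ?case using tensm_comp[of "msum C f n" _ _ "msum C g n" _ "f (Suc n)"] by simp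
qed

lemma msum_add:
  assumes "\<And>i. f i \<in> homset C (y i) (z i)"
  shows "msum C f (k + d) = msum C f k \<oplus>\<^sub>m msum C (\<lambda>i. f (k + i)) d"
proof (induction d)
  case 0
  have "msum C f k \<in> homset C (osum C y k) (osum C z k)" using assms by (rule msum_closed)
  then show ?case by (simp add: tensm_unit_right homset_def)
next
  case (Suc d)
  have "msum C f k \<in> homset C (osum C y k) (osum C z k)" using assms by (rule msum_closed)
  moreover have "msum C (\<lambda>i. f (k + i)) d \<in> homset C (osum C (\<lambda>i. y (k + i)) d) (osum C (\<lambda>i. z (k + i)) d)"
    using assms by (rule msum_closed)
  ultimately show ?case using Suc assms[of "Suc (k + d)"] by (simp add: tensm_assoc homset_def)
qed

lemma osum_opow: "x \<in> Ob C \<Longrightarrow> osum C (\<lambda>i. opow C x (k i)) n = opow C x (\<Sum>i=1..n. k i)"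
  by (induction n) (simp_all add: opow_add)

context
  assumes null: "is_null C (Unit C)"
begin

lemma phi_tuple_closed: "y i \<in> Ob C \<Longrightarrow> phi C y R i \<in> homset C (y i) (y i)"
  by (simp add: phi_def id_closed zero_mor_closed[OF null])

text \<open>If \<open>i \<in> R\<close> the right-hand side is
  \<open>\<alpha>' \<cdot> \<alpha>\<close>; otherwise it contains a zero factor.\<close>

lemma phi_retract:
  assumes "\<alpha> \<in> homset C (y i) (z i)" "\<alpha>' \<in> homset C (z i) (y i)" "\<alpha>' \<cdot> \<alpha> = Ident C (y i)"
  shows "phi C y R i = \<alpha>' \<cdot> (phi C z R i \<cdot> \<alpha>)"
proof -
  have "y i \<in> Ob C" "z i \<in> Ob C" using homset_Ob[OF assms(1)] by auto
  then show ?thesis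
    using assms by (simp add: phi_def comp_id_left[OF assms(1)] comp_zero_left[OF null assms(1)]
        comp_zero_right[OF null assms(2)])
qed

context
  fixes x
  assumes x: "x \<in> Ob C"
begin

section \<open>Coordinate projections of powers of \<open>x\<close>\<close>

lemma coord_proj_empty: "coord_proj C x {} n = zero_mor C (opow C x n) (opow C x n)"
  by (induction n) (simp_all add: zero_mor_unit[OF null] phi_def tensm_zero[OF null] opow_closed x)

lemma coord_proj_add:
  assumes "\<And>i. i \<in> {1..d} \<Longrightarrow> k + i \<in> V \<longleftrightarrow> i \<in> W"
  shows "coord_proj C x V (k + d) = coord_proj C x V k \<oplus>\<^sub>m coord_proj C x W d"
proof -
  have "coord_proj C x V (k + d) = coord_proj C x V k \<oplus>\<^sub>m msum C (\<lambda>i. phi C (\<lambda>_. x) V (k + i)) d"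
    by (rule msum_add[of _ "\<lambda>_. x" "\<lambda>_. x"]) (rule phi_closed[OF null x])
  also have "msum C (\<lambda>i. phi C (\<lambda>_. x) V (k + i)) d = coord_proj C x W d"
    using assms by (intro msum_cong) (simp add: phi_def)
  finally show ?thesis .
qed

text \<open>The \<open>i\<close>-th summand occupies the coordinates from
  \<open>K (i - 1) + 1\<close> to \<open>K i\<close>. On it the identity is the projection onto all
  of these coordinates and the zero morphism is the projection onto none.\<close>

lemma msum_phi_blocks:
  fixes k :: "nat \<Rightarrow> nat"
  defines "K \<equiv> \<lambda>n. \<Sum>i=1..n. k i"
  assumes "\<And>i j. i < n \<Longrightarrow> j \<in> {K i<..K (Suc i)} \<Longrightarrow> j \<in> V \<longleftrightarrow> Suc i \<in> R"
  shows "msum C (phi C (\<lambda>i. opow C x (k i)) R) n = coord_proj C x V (K n)"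
  using assms(2)
proof (induction n)
  case 0
  show ?case by (simp add: K_def)
next
  case (Suc n)
  \<comment> \<open>The part of \<open>V\<close> in the last block, with coordinates counted from 1
    again.\<close>
  define W where "W = (if Suc n \<in> R then {1..k (Suc n)} else {})"
  have KS: "K (Suc n) = K n + k (Suc n)" by (simp add: K_def)
  have "coord_proj C x W (k (Suc n)) = phi C (\<lambda>i. opow C x (k i)) R (Suc n)"
    by (simp add: W_def phi_def coord_proj_empty msum_phi_id[OF null x])
  moreover have "K n + i \<in> V \<longleftrightarrow> i \<in> W" if "i \<in> {1..k (Suc n)}" for i
    using Suc.prems[of n "K n + i"] that by (simp add: KS W_def)
  then have "coord_proj C x V (K (Suc n)) = coord_proj C x V (K n) \<oplus>\<^sub>m coord_proj C x W (k (Suc n))"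
    unfolding KS by (rule coord_proj_add)
  ultimately show ?case
    using Suc.IH Suc.prems by simp
qed

text \<open>Since the unit is strict and null, the summands with index outside \<open>U\<close> can be dropped in place.\<close>

lemma coord_proj_compress:
  assumes "finite U" "0 \<notin> U"
  shows "\<exists>\<iota> \<in> homset C (opow C x (card (U \<inter> {1..N}))) (opow C x N).
    \<exists>\<pi> \<in> homset C (opow C x N) (opow C x (card (U \<inter> {1..N}))). \<forall>V \<subseteq> U.
      coord_proj C x V N = \<iota> \<cdot> (coord_proj C x ((\<lambda>j. card (U \<inter> {1..j})) ` V) (card (U \<inter> {1..N})) \<cdot> \<pi>)"
proof (induction N)
  case 0
  have "Ident C (Unit C) \<in> homset C (Unit C) (Unit C)" by (simp add: id_closed unit_closed)
  then show ?case
    by (intro bexI[of _ "Ident C (Unit C)"]) (simp_all add: comp_id_left)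
next
  case (Suc N)
  define r where "r = (\<lambda>j. card (U \<inter> {1..j}))"
  have r_eq: "card (U \<inter> {1..j}) = r j" for j by (simp add: r_def)
  define u where "u = r N"
  obtain \<iota> \<pi> where \<iota>: "\<iota> \<in> homset C (opow C x u) (opow C x N)"
    and \<pi>: "\<pi> \<in> homset C (opow C x N) (opow C x u)"
    and eq: "\<And>V. V \<subseteq> U \<Longrightarrow> coord_proj C x V N = \<iota> \<cdot> (coord_proj C x (r ` V) u \<cdot> \<pi>)"
    using Suc.IH unfolding r_eq u_def[symmetric] by blast
  have pc: "coord_proj C x V n \<in> homset C (opow C x n) (opow C x n)" for V n
    by (rule msum_phi_closed[OF null x])
  \<comment> \<open>The interchange law, for one further coordinate with a factorisation of its own.
    Below, \<open>b\<close> is \<open>x\<close> if that coordinate lies in \<open>U\<close>, and the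
    unit object otherwise.\<close>
  have split: "coord_proj C x V N \<oplus>\<^sub>m (h \<cdot> (f \<cdot> g)) = (\<iota> \<oplus>\<^sub>m h) \<cdot> ((coord_proj C x (r ` V) u \<oplus>\<^sub>m f) \<cdot> (\<pi> \<oplus>\<^sub>m g))"
    if "V \<subseteq> U" "g \<in> homset C a b" "f \<in> homset C b b" "h \<in> homset C b a" for V a b f g h
    unfolding eq[OF that(1)] tensm_comp[OF comp_closed[OF \<pi> pc] \<iota> comp_closed[OF that(2,3)] that(4)]
      tensm_comp[OF \<pi> pc that(2,3)] by (rule refl)
  show ?case
  proof (cases "Suc N \<in> U")
    case True
    have "U \<inter> {1..Suc N} = insert (Suc N) (U \<inter> {1..N})" using True by auto
    then have r: "r (Suc N) = Suc u" by (simp add: r_def u_def)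
    have id: "Ident C x \<in> homset C x x" using x by (rule id_closed)
    have "coord_proj C x V (Suc N) = (\<iota> \<oplus>\<^sub>m Ident C x) \<cdot> (coord_proj C x (r ` V) (Suc u) \<cdot> (\<pi> \<oplus>\<^sub>m Ident C x))"
      if "V \<subseteq> U" for V
    proof -
      \<comment> \<open>\<open>Suc u\<close> is the rank of \<open>Suc N\<close>, and ranks are
        injective on \<open>U\<close>.\<close>
      have "Suc u \<in> r ` V \<longleftrightarrow> Suc N \<in> V"
        using inj_on_image_mem_iff[of r U "Suc N" V] bij_betw_rank[OF assms, folded r_def] True that
        by (simp add: bij_betw_def r)
      then have "phi C (\<lambda>_. x) (r ` V) (Suc u) = phi C (\<lambda>_. x) V (Suc N)"
        by (simp add: phi_def)
      then show ?thesis
        using split[OF that id phi_closed[OF null x, of V "Suc N"] id]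
          comp_id_left[OF phi_closed[OF null x]] comp_id_right[OF phi_closed[OF null x]] by simp
    qed
    moreover have "\<iota> \<oplus>\<^sub>m Ident C x \<in> homset C (opow C x (Suc u)) (opow C x (Suc N))"
      "\<pi> \<oplus>\<^sub>m Ident C x \<in> homset C (opow C x (Suc N)) (opow C x (Suc u))"
      using tensm_closed[OF \<iota> id] tensm_closed[OF \<pi> id] by simp_all
    ultimately show ?thesis unfolding r_eq r by (intro bexI allI impI)
  next
    case False
    have "U \<inter> {1..Suc N} = U \<inter> {1..N}" using False by (auto simp: le_Suc_eq)
    then have r: "r (Suc N) = u" by (simp add: r_def u_def)
    \<comment> \<open>A coordinate outside \<open>U\<close> carries the zero endomorphism for every
      \<open>V \<subseteq> U\<close>. Routing it through the unit leaves the middle power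
      \<open>opow C x u\<close> unchanged.\<close>
    obtain g h where g: "g \<in> homset C x (Unit C)" and h: "h \<in> homset C (Unit C) x"
      and gh: "zero_mor C x x = h \<cdot> g" using zero_morE[OF null x x] by blast
    have "coord_proj C x V (Suc N) = (\<iota> \<oplus>\<^sub>m h) \<cdot> (coord_proj C x (r ` V) u \<cdot> (\<pi> \<oplus>\<^sub>m g))"
      if "V \<subseteq> U" for V
    proof -
      have "phi C (\<lambda>_. x) V (Suc N) = h \<cdot> (Ident C (Unit C) \<cdot> g)"
        using False that comp_id_left[OF g] by (auto simp: phi_def gh)
      moreover have "coord_proj C x (r ` V) u \<oplus>\<^sub>m Ident C (Unit C) = coord_proj C x (r ` V) u"
        using pc[of "r ` V" u] by (simp add: tensm_unit_right homset_def)
      ultimately show ?thesis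
        using split[OF that g id_closed[OF unit_closed] h] by simp
    qed
    moreover have "\<iota> \<oplus>\<^sub>m h \<in> homset C (opow C x u) (opow C x (Suc N))"
      "\<pi> \<oplus>\<^sub>m g \<in> homset C (opow C x (Suc N)) (opow C x u)"
      using tensm_closed[OF \<iota> h] tensm_closed[OF \<pi> g] by (simp_all add: tenso_unit_right opow_closed x)
    ultimately show ?thesis unfolding r_eq r by (intro bexI allI impI)
  qed
qed

end

end

end

section \<open>Comparison of the heights\<close>

locale functor_to_abelian =
  C: strict_monoidal_category C + A: abelian_category A + F: cat_functor C A T
  for C :: "('o, 'm, 'y) mcat_scheme" and A :: "('p, 'n, 'z) acat_scheme"
    and T :: "('o, 'm, 'p, 'n) fctr" +
  fixes x :: 'o
  assumes null: "is_null C (Unit C)" and x: "x \<in> Ob C"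
begin

abbreviation T_pow :: "nat \<Rightarrow> 'p" where
  "T_pow n \<equiv> OMap T (opow C x n)"

abbreviation T_proj :: "nat set \<Rightarrow> nat \<Rightarrow> 'n" where
  "T_proj V n \<equiv> AMap T (coord_proj C x V n)"

text \<open>The alternating sum is the idempotent whose image is the cross-effect of
  \<open>T\<close> at \<open>n\<close> copies of \<open>x\<close>. Both height conditions are
  reduced to its vanishing.\<close>

definition cross_effect_zero :: "nat \<Rightarrow> bool" where
  "cross_effect_zero n \<longleftrightarrow>
     alt_sum A (T_pow n) {1..n} (\<lambda>S. T_proj ({1..n} - S) n) = ZeroM A (T_pow n) (T_pow n)"

lemma T_pow_closed: "T_pow n \<in> Ob A"
  using x by (simp add: F.omap_closed C.opow_closed)

lemma T_proj_closed: "T_proj V n \<in> homset A (T_pow n) (T_pow n)"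
  using F.amap_closed C.msum_phi_closed[OF null x] by blast

text \<open>One pair \<open>\<iota>\<close>, \<open>\<pi>\<close> factors the projections for all
  \<open>V \<subseteq> U\<close> through \<open>opow C x (card U)\<close>. By additivity the whole
  sum factors through the cross-effect there.\<close>

lemma alt_sum_subset_eq_ZeroM:
  assumes "U \<subseteq> {1..N}" "cross_effect_zero (card U)"
  shows "alt_sum A (T_pow N) U (\<lambda>S. T_proj (U - S) N) = ZeroM A (T_pow N) (T_pow N)"
proof -
  define u where "u = card U"
  define r where "r = (\<lambda>j. card (U \<inter> {1..j}))"
  have U: "finite U" "0 \<notin> U" "U \<inter> {1..N} = U"
    using assms(1) finite_subset[of U "{1..N}"] by auto
  have bij: "bij_betw r U {1..u}"
    unfolding r_def u_def using bij_betw_rank[OF U(1,2)] .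
  obtain \<iota> \<pi> where \<iota>: "\<iota> \<in> homset C (opow C x u) (opow C x N)"
    and \<pi>: "\<pi> \<in> homset C (opow C x N) (opow C x u)"
    and eq: "\<And>V. V \<subseteq> U \<Longrightarrow> coord_proj C x V N = \<iota> \<cdot>\<^bsub>C\<^esub> (coord_proj C x (r ` V) u \<cdot>\<^bsub>C\<^esub> \<pi>)"
    using C.coord_proj_compress[OF null x U(1,2), of N] unfolding U(3) u_def r_def by blast
  have pc: "coord_proj C x V u \<in> homset C (opow C x u) (opow C x u)" for V
    by (rule C.msum_phi_closed[OF null x])
  have T\<iota>: "AMap T \<iota> \<in> homset A (T_pow u) (T_pow N)" and T\<pi>: "AMap T \<pi> \<in> homset A (T_pow N) (T_pow u)"
    using F.amap_closed \<iota> \<pi> by blast+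
  have Teq: "T_proj V N = AMap T \<iota> \<cdot>\<^bsub>A\<^esub> (T_proj (r ` V) u \<cdot>\<^bsub>A\<^esub> AMap T \<pi>)" if "V \<subseteq> U" for V
    unfolding eq[OF that] F.amap_comp[OF C.comp_closed[OF \<pi> pc] \<iota>] F.amap_comp[OF \<pi> pc] ..
  have closed: "(\<lambda>S. T_proj (f S) u) \<in> X \<rightarrow> homset A (T_pow u) (T_pow u)" for f and X :: "nat set set"
    using T_proj_closed by blast
  \<comment> \<open>The numbering by rank turns complements in \<open>U\<close> into complements in
    \<open>{1..u}\<close>.\<close>
  have "alt_sum A (T_pow u) U (\<lambda>S. T_proj (r ` (U - S)) u) = alt_sum A (T_pow u) U (\<lambda>S. T_proj ({1..u} - r ` S) u)"
  proof (rule A.alt_sum_cong[OF T_pow_closed _ closed])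
    fix S assume "S \<subseteq> U"
    then have "r ` (U - S) = {1..u} - r ` S"
      using bij inj_on_image_set_diff[of r U U S] unfolding bij_betw_def by auto
    then show "T_proj (r ` (U - S)) u = T_proj ({1..u} - r ` S) u" by simp
  qed
  also have "\<dots> = alt_sum A (T_pow u) {1..u} (\<lambda>S. T_proj ({1..u} - S) u)"
    by (rule A.alt_sum_reindex[OF T_pow_closed closed bij, symmetric])
  also have "\<dots> = ZeroM A (T_pow u) (T_pow u)"
    using assms(2) unfolding cross_effect_zero_def u_def .
  finally have "alt_sum A (T_pow N) U (\<lambda>S. AMap T \<iota> \<cdot>\<^bsub>A\<^esub> (T_proj (r ` (U - S)) u \<cdot>\<^bsub>A\<^esub> AMap T \<pi>))
      = ZeroM A (T_pow N) (T_pow N)"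
    by (rule A.alt_sum_comp_eq_ZeroM[OF T\<iota> T\<pi> closed])
  moreover have "T_proj (U - S) N = AMap T \<iota> \<cdot>\<^bsub>A\<^esub> (T_proj (r ` (U - S)) u \<cdot>\<^bsub>A\<^esub> AMap T \<pi>)" for S
    by (rule Teq) blast
  ultimately show ?thesis by simp
qed

text \<open>For an endomorphism of \<open>m\<close>, the trailing zero morphism in
  \<open>s_fctr\<close> lives on the unit object, where it is the identity, so it drops out.\<close>

lemma alt_sum_I_eq:
  "alt_sum A (OMap (fcomp T (s_fctr C x)) m) {m - n + 1..m}
      (\<lambda>S. AMap (fcomp T (s_fctr C x)) (f_mor m (S \<union> {1..m - n}))) =
    alt_sum A (T_pow m) {m - n + 1..m} (\<lambda>S. T_proj ({m - n + 1..m} - S) m)"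
proof -
  have "AMap (s_fctr C x) (f_mor m (S \<union> {1..m - n})) = coord_proj C x ({m - n + 1..m} - S) m" for S
  proof -
    have "{1..m} - (S \<union> {1..m - n}) = {m - n + 1..m} - S" by auto
    moreover have "coord_proj C x V m \<in> Ar C" for V
      using C.msum_phi_closed[OF null x] unfolding homset_def by blast
    ultimately show ?thesis
      by (simp add: f_mor_def s_fctr_def C.zero_mor_unit[OF null] C.tensm_unit_right)
  qed
  then show ?thesis by (simp add: fcomp_def s_fctr_def)
qed

text \<open>The case \<open>m = n\<close> is the vanishing of the cross-effect itself; for larger
  \<open>m\<close> the last \<open>n\<close> coordinates form a set \<open>U\<close> with
  \<open>n\<close> elements.\<close>

lemma I_condition_iff:
  "(\<forall>m \<ge> n. has_zero_image A (alt_sum A (OMap (fcomp T (s_fctr C x)) m) {m - n + 1..m}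
     (\<lambda>S. AMap (fcomp T (s_fctr C x)) (f_mor m (S \<union> {1..m - n}))))) \<longleftrightarrow> cross_effect_zero n"
  (is "(\<forall>m \<ge> n. ?P m) \<longleftrightarrow> _")
proof -
  have P: "?P m \<longleftrightarrow> alt_sum A (T_pow m) {m - n + 1..m} (\<lambda>S. T_proj ({m - n + 1..m} - S) m) =
      ZeroM A (T_pow m) (T_pow m)" for m
    unfolding alt_sum_I_eq
    by (rule A.has_zero_image_iff[OF A.alt_sum_closed[OF T_pow_closed]]) (use T_proj_closed in blast)
  have "?P n \<longleftrightarrow> cross_effect_zero n"
    using P[of n] by (simp add: cross_effect_zero_def)
  moreover have "?P m" if "n \<le> m" "cross_effect_zero n" for m
    unfolding P using that by (intro alt_sum_subset_eq_ZeroM) auto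
  ultimately show ?thesis by blast
qed

text \<open>The sum of the tuple is a single power of \<open>x\<close> whose coordinates are
  partitioned into blocks. The sets \<open>U\<close> meeting all \<open>n\<close> blocks may be
  larger than \<open>n\<close>, hence the hypothesis for every \<open>m \<ge> n\<close>.\<close>

lemma alt_sum_powers_eq_ZeroM:
  fixes k :: "nat \<Rightarrow> nat"
  assumes zero: "\<And>m. n \<le> m \<Longrightarrow> cross_effect_zero m"
  defines "y \<equiv> \<lambda>i. opow C x (k i)"
  shows "alt_sum A (OMap T (osum C y n)) {1..n} (\<lambda>S. AMap T (msum C (phi C y ({1..n} - S)) n)) =
    ZeroM A (OMap T (osum C y n)) (OMap T (osum C y n))"
proof -
  define K where "K n = (\<Sum>i=1..n. k i)" for n
  \<comment> \<open>The block containing the coordinate \<open>j\<close>. Taking the least index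
    skips empty blocks, which arise when \<open>k i = 0\<close>.\<close>
  define t where "t j = (LEAST i. j \<le> K i)" for j
  let ?N = "{1..K n}"
  have K0: "K 0 = 0" by (simp add: K_def)
  have mono: "K i \<le> K j" if "i \<le> j" for i j
    unfolding K_def using that by (intro sum_mono2) auto
  have t_block: "t j = Suc i" if "j \<in> {K i<..K (Suc i)}" for i j
    unfolding t_def
  proof (rule Least_equality)
    fix l assume "j \<le> K l"
    then show "Suc i \<le> l" using mono[of l i] that by (cases "l \<le> i") auto
  qed (use that in simp)
  have t_range: "t ` ?N \<subseteq> {1..n}"
  proof (rule image_subsetI)
    fix j assume j: "j \<in> ?N"
    then have "t j \<le> n" unfolding t_def by (simp add: Least_le)
    moreover have "j \<le> K (t j)" unfolding t_def by (rule LeastI[of _ n]) (use j in simp)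
    then have "t j \<noteq> 0" using j K0 by (cases "t j = 0") auto
    ultimately show "t j \<in> {1..n}" by simp
  qed
  have obj: "osum C y n = opow C x (K n)"
    unfolding y_def K_def by (rule C.osum_opow[OF x])
  have blocks: "msum C (phi C y ({1..n} - S)) n = coord_proj C x {j \<in> ?N. t j \<notin> S} (K n)" for S
    unfolding y_def K_def
  proof (rule C.msum_phi_blocks[OF null x], fold K_def)
    fix i j assume i: "i < n" and j: "j \<in> {K i<..K (Suc i)}"
    have "j \<in> ?N" using j mono[of "Suc i" n] i by auto
    then show "j \<in> {j \<in> ?N. t j \<notin> S} \<longleftrightarrow> Suc i \<in> {1..n} - S"
      using t_block[OF j] i by simp
  qed
  interpret G: comm_group "hom_group A (T_pow (K n)) (T_pow (K n))"
    by (rule A.hom_comm_group[OF T_pow_closed T_pow_closed])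
  have "alt_sum A (T_pow (K n)) {1..n} (\<lambda>S. T_proj {j \<in> ?N. t j \<notin> S} (K n)) =
      ZeroM A (T_pow (K n)) (T_pow (K n))"
    unfolding alt_sum_def A.hom_group_simps(3)[symmetric]
  proof (rule G.alternating_finprod_fibres[OF _ _ t_range, where g = "\<lambda>V. T_proj V (K n)"])
    show "(\<lambda>V. T_proj V (K n)) \<in> Pow ?N \<rightarrow> carrier (hom_group A (T_pow (K n)) (T_pow (K n)))"
      unfolding A.hom_group_simps using T_proj_closed by blast
  next
    fix U assume U: "U \<subseteq> ?N" "t ` U = {1..n}"
    have "card (t ` U) \<le> card U" using U(1) finite_subset by (blast intro: card_image_le)
    then have n: "n \<le> card U" unfolding U(2) by simp
    show "finprod (hom_group A (T_pow (K n)) (T_pow (K n)))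
        (\<lambda>S. T_proj (U - S) (K n) [^]\<^bsub>hom_group A (T_pow (K n)) (T_pow (K n))\<^esub> ((-1) ^ card S :: int)) (Pow U)
        = \<one>\<^bsub>hom_group A (T_pow (K n)) (T_pow (K n))\<^esub>"
      using alt_sum_subset_eq_ZeroM[OF U(1) zero[OF n]] unfolding alt_sum_def A.hom_group_simps(3) .
  qed simp_all
  then show ?thesis unfolding obj blocks .
qed

text \<open>Generation provides isomorphisms from the \<open>y i\<close> to powers of
  \<open>x\<close>; their sums conjugate the alternating sum into that of a tuple of powers.\<close>

lemma alt_sum_tuple_eq_ZeroM:
  assumes zero: "\<And>m. n \<le> m \<Longrightarrow> cross_effect_zero m" and gen: "generated_by C x"
    and y: "\<And>i. i \<in> {1..n} \<Longrightarrow> y i \<in> Ob C"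
  shows "alt_sum A (OMap T (osum C y n)) {1..n} (\<lambda>S. AMap T (msum C (phi C y ({1..n} - S)) n)) =
    ZeroM A (OMap T (osum C y n)) (OMap T (osum C y n))"
proof -
  have "\<exists>k f g. f \<in> homset C (y i) (opow C x k) \<and> g \<in> homset C (opow C x k) (y i) \<and>
      g \<cdot>\<^bsub>C\<^esub> f = Ident C (y i)" if i: "i \<in> {1..n}" for i
  proof -
    obtain k f where f: "f \<in> homset C (y i) (opow C x k)" "is_iso C f"
      using gen y[OF i] unfolding generated_by_def isomorphic_def by blast
    moreover from f(1) have "Dom C f = y i" "Cod C f = opow C x k" by (auto simp: homset_def)
    ultimately show ?thesis unfolding is_iso_def by metis
  qed
  then obtain k \<alpha> \<alpha>' where \<alpha>: "\<And>i. i \<in> {1..n} \<Longrightarrow> \<alpha> i \<in> homset C (y i) (opow C x (k i))"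
    and \<alpha>': "\<And>i. i \<in> {1..n} \<Longrightarrow> \<alpha>' i \<in> homset C (opow C x (k i)) (y i)"
    and inv: "\<And>i. i \<in> {1..n} \<Longrightarrow> \<alpha>' i \<cdot>\<^bsub>C\<^esub> \<alpha> i = Ident C (y i)"
    by metis
  define z where "z = (\<lambda>i. opow C x (k i))"
  have phi: "phi C z R i \<in> homset C (z i) (z i)" for R i
    by (rule C.phi_tuple_closed[OF null]) (simp add: z_def C.opow_closed x)
  have za: "\<alpha> i \<in> homset C (y i) (z i)" "\<alpha>' i \<in> homset C (z i) (y i)" if "i \<in> {1..n}" for i
    using \<alpha>[OF that] \<alpha>'[OF that] by (simp_all add: z_def)
  have a: "msum C \<alpha> n \<in> homset C (osum C y n) (osum C z n)"
    and a': "msum C \<alpha>' n \<in> homset C (osum C z n) (osum C y n)"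
    by (rule C.msum_closed[OF za(1)] C.msum_closed[OF za(2)], assumption)+
  have p: "msum C (phi C z R) n \<in> homset C (osum C z n) (osum C z n)" for R
    using phi by (rule C.msum_closed)
  have eq: "msum C (phi C y R) n = msum C \<alpha>' n \<cdot>\<^bsub>C\<^esub> (msum C (phi C z R) n \<cdot>\<^bsub>C\<^esub> msum C \<alpha> n)" for R
  proof -
    have "msum C (phi C y R) n = msum C (\<lambda>i. \<alpha>' i \<cdot>\<^bsub>C\<^esub> (phi C z R i \<cdot>\<^bsub>C\<^esub> \<alpha> i)) n"
      by (rule C.msum_cong) (rule C.phi_retract[OF null za inv])
    also have "\<dots> = msum C \<alpha>' n \<cdot>\<^bsub>C\<^esub> msum C (\<lambda>i. phi C z R i \<cdot>\<^bsub>C\<^esub> \<alpha> i) n"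
      by (rule C.msum_comp[OF C.comp_closed[OF za(1) phi] za(2)])
    also have "msum C (\<lambda>i. phi C z R i \<cdot>\<^bsub>C\<^esub> \<alpha> i) n = msum C (phi C z R) n \<cdot>\<^bsub>C\<^esub> msum C \<alpha> n"
      by (rule C.msum_comp[OF za(1) phi])
    finally show ?thesis .
  qed
  have Teq: "AMap T (msum C (phi C y R) n) =
      AMap T (msum C \<alpha>' n) \<cdot>\<^bsub>A\<^esub> (AMap T (msum C (phi C z R) n) \<cdot>\<^bsub>A\<^esub> AMap T (msum C \<alpha> n))" for R
    unfolding eq F.amap_comp[OF C.comp_closed[OF a p] a'] F.amap_comp[OF a p] ..
  show ?thesis
    unfolding Teq
  proof (rule A.alt_sum_comp_eq_ZeroM[OF F.amap_closed[OF a'] F.amap_closed[OF a]])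
    show "(\<lambda>S. AMap T (msum C (phi C z ({1..n} - S)) n)) \<in> Pow {1..n} \<rightarrow>
        homset A (OMap T (osum C z n)) (OMap T (osum C z n))"
      using F.amap_closed[OF p] by blast
  qed (use alt_sum_powers_eq_ZeroM[OF zero] in \<open>simp add: z_def\<close>)
qed

text \<open>Constant tuples give one direction. The equivalence is stated for all
  \<open>n > h\<close> together because a tuple of length \<open>n\<close> involves the
  cross-effects of every order \<open>m \<ge> n\<close>.\<close>

lemma oplus_condition_iff:
  assumes "generated_by C x"
  shows "(\<forall>n. int n > h \<longrightarrow> (\<forall>y. (\<forall>i \<in> {1..n}. y i \<in> Ob C) \<longrightarrow>
      has_zero_image A (alt_sum A (OMap T (osum C y n)) {1..n}
        (\<lambda>S. AMap T (msum C (phi C y ({1..n} - S)) n))))) \<longleftrightarrow>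
    (\<forall>n. int n > h \<longrightarrow> cross_effect_zero n)"
proof -
  have iff: "has_zero_image A (alt_sum A (OMap T (osum C y n)) {1..n}
        (\<lambda>S. AMap T (msum C (phi C y ({1..n} - S)) n))) \<longleftrightarrow>
      alt_sum A (OMap T (osum C y n)) {1..n} (\<lambda>S. AMap T (msum C (phi C y ({1..n} - S)) n)) =
      ZeroM A (OMap T (osum C y n)) (OMap T (osum C y n))"
    if y: "\<forall>i \<in> {1..n}. y i \<in> Ob C" for y n
  proof (rule A.has_zero_image_iff[OF A.alt_sum_closed])
    show "OMap T (osum C y n) \<in> Ob A"
      using y by (intro F.omap_closed C.osum_closed) blast
    have "msum C (phi C y R) n \<in> homset C (osum C y n) (osum C y n)" for R
      using y by (intro C.msum_closed C.phi_tuple_closed[OF null]) blast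
    then show "(\<lambda>S. AMap T (msum C (phi C y ({1..n} - S)) n)) \<in> Pow {1..n} \<rightarrow>
        homset A (OMap T (osum C y n)) (OMap T (osum C y n))"
      using F.amap_closed by blast
  qed
  show ?thesis
  proof (intro iffI allI impI)
    fix n y assume zero: "\<forall>n. int n > h \<longrightarrow> cross_effect_zero n" "int n > h" and y: "\<forall>i \<in> {1..n}. y i \<in> Ob C"
    show "has_zero_image A (alt_sum A (OMap T (osum C y n)) {1..n}
        (\<lambda>S. AMap T (msum C (phi C y ({1..n} - S)) n)))"
      unfolding iff[OF y] using zero y by (intro alt_sum_tuple_eq_ZeroM assms) simp_all
  next
    fix n assume zero: "\<forall>n. int n > h \<longrightarrow> (\<forall>y. (\<forall>i \<in> {1..n}. y i \<in> Ob C) \<longrightarrow>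
      has_zero_image A (alt_sum A (OMap T (osum C y n)) {1..n}
        (\<lambda>S. AMap T (msum C (phi C y ({1..n} - S)) n))))" and n: "int n > h"
    have "has_zero_image A (alt_sum A (T_pow n) {1..n} (\<lambda>S. T_proj ({1..n} - S) n))"
      using zero[rule_format, OF n, of "\<lambda>_. x"] x by blast
    then show "cross_effect_zero n"
      using iff[of n "\<lambda>_. x"] x unfolding cross_effect_zero_def by blast
  qed
qed

text \<open>Both heights are infima over sets of bounds \<open>h\<close>, and for each
  \<open>h\<close> both membership conditions amount to \<open>cross_effect_zero n\<close> for all
  \<open>n > h\<close>.\<close>

lemma ht_I_eq_ht_oplus:
  assumes "generated_by C x"
  shows "ht_I C x A T = ht_oplus C A T"
  unfolding ht_I_def ht_oplus_def height_def I_condition_iff oplus_condition_iff[OF assms] ..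

end

theorem proposition3p5:
  fixes C :: "('o, 'm, 'y) mcat_scheme"
    and x :: 'o
    and A :: "('p, 'n, 'z) acat_scheme"
    and T :: "('o, 'm, 'p, 'n) fctr"
  assumes "strict_monoidal_category C"
    and "is_null C (Unit C)"
    and "generated_by C x"
    and "abelian_category A"
    and "cat_functor C A T"
  shows "ht_I C x A T \<le> ht_oplus C A T \<and> (braided C \<longrightarrow> ht_I C x A T = ht_oplus C A T)"
proof -
  have "functor_to_abelian C A T x"
    using assms by (simp add: functor_to_abelian_def functor_to_abelian_axioms_def generated_by_def)
  then have "ht_I C x A T = ht_oplus C A T"
    using assms(3) by (rule functor_to_abelian.ht_I_eq_ht_oplus)
  then show ?thesis by simp
qed

end
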